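(* The arithmetic progression $q\equiv 269363\pmod{471240}$ contains infinitely many primes. For every such prime $q$, put $n=q+1$. Then $v_3(n)=1$, $v_2(n)=2$, none of $n+1,n+2,n+3,n+4$ is a prime power, and $n\neq 2p$ for every prime $p$. Consequently, the APN permutations $F_M$ of $\mathbb Z_n$ (with $M\in\mathrm{PGL}_2(q)$, $MJ\neq JM$) have orders $n$ that are not of any of the forms $r-1,r-2,r-3,r-4$ with $r$ a prime power.
   Context: $v_\ell(n)$ denotes the $\ell$-adic valuation of $n$. $\mathbb Z_n=\mathbb Z/n\mathbb Z$. A map $F:\mathbb Z_n\to\mathbb Z_n$ is APN if $\max_{u\neq 0,\,v}\#\{x: F(x+u)-F(x)=v\}=2$. For an odd prime power $q$ and $n=q+1$: let $C\le\mathrm{PGL}_2(q)$ be a Singer group (a cyclic subgroup of order $q+1$; it acts regularly on $\mathbb P^1(\mathbb F_q)$), $R$ a generator of $C$, $P_0\in\mathbb P^1(\mathbb F_q)$ a base point, and $J=R^{n/2}$. For $M\in\mathrm{PGL}_2(q)$, $F_M$ is the permutation of $\mathbb Z_n$ with $F_M(i)=j$ iff $M(R^iP_0)=R^jP_0$; it is APN when $MJ\neq JM$. The order of a permutation of $\mathbb Z_n$ here means the order $n$ of its domain. The forms $r-1$, $r-2$, $r-3$, $r-4$ are the order forms of the Welch--Costas and Panario--Sakzad--Stevens--Wang classes ($r-1$) and the standard Golomb classes ($r-2,r-3,r-4$). *)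

theory Defs
  imports
    "HOL-Analysis.Determinants"
    "HOL-Algebra.Elementary_Groups"
    "HOL-Number_Theory.Number_Theory"
begin

text \<open>The field $\mathbb{F}_q$ is an arbitrary type of sort \<open>{field,finite}\<close>, with
  $q$ its cardinality.\<close>

definition GL2 :: "('k::field ^ 2 ^ 2) monoid" where
  "GL2 = \<lparr>carrier = {A. invertible A}, mult = (**), one = mat 1\<rparr>"

definition scalars2 :: "('k::field ^ 2 ^ 2) set" where
  "scalars2 = {mat c | c. c \<noteq> 0}"

type_synonym 'k pgl2 = "('k ^ 2 ^ 2) set"

definition PGL2 :: "'k::field pgl2 monoid" where
  "PGL2 = GL2 Mod scalars2"

text \<open>Points of the projective line are the one-dimensional subspaces of $K^2$.\<close>

definition proj_line :: "('k::field ^ 2) set set" where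
  "proj_line = {vec.span {v} | v. v \<noteq> 0}"

text \<open>All representatives $A$ of a class $M$ map the line $P$ to the same line, so for
  \<open>P \<in> proj_line\<close> the union below is that common image.\<close>

definition pgl2_act :: "'k::field pgl2 \<Rightarrow> ('k ^ 2) set \<Rightarrow> ('k ^ 2) set" where
  "pgl2_act M P = (\<Union>A\<in>M. (\<lambda>v. A *v v) ` P)"

definition singer_group :: "'k::{field,finite} pgl2 set \<Rightarrow> bool" where
  "singer_group C \<longleftrightarrow>
     subgroup C PGL2 \<and> cyclic_group (PGL2\<lparr>carrier := C\<rparr>) \<and> card C = CARD('k) + 1"

text \<open>The map $F_M$ on $\mathbb{Z}_{q+1}$, relative to the generator $R$ of a Singer group
  and the base point $P_0$: $F_M(i)$ is the unique $j$ with $M(R^i P_0) = R^j P_0$.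
  Values at arguments outside \<open>{0..q}\<close> are irrelevant.\<close>

definition singer_map ::
  "'k::{field,finite} pgl2 \<Rightarrow> ('k ^ 2) set \<Rightarrow> 'k pgl2 \<Rightarrow> int \<Rightarrow> int" where
  "singer_map R P0 M i =
     (THE j. j \<in> carrier (residue_ring (int (CARD('k) + 1))) \<and>
        pgl2_act M (pgl2_act (R [^]\<^bsub>PGL2\<^esub> i) P0) = pgl2_act (R [^]\<^bsub>PGL2\<^esub> j) P0)"

definition APN :: "nat \<Rightarrow> (int \<Rightarrow> int) \<Rightarrow> bool" where
  "APN n F \<longleftrightarrow>
     (let Z = residue_ring (int n) in
      Max {card {x \<in> carrier Z. F (x \<oplus>\<^bsub>Z\<^esub> u) \<ominus>\<^bsub>Z\<^esub> F x = v} | u v.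
             u \<in> carrier Z \<and> u \<noteq> \<zero>\<^bsub>Z\<^esub> \<and> v \<in> carrier Z} = 2)"

end

theory Submission
  imports Defs "HOL-Computational_Algebra.Squarefree" "HOL-Analysis.Summation_Tests"
begin

text \<open>
  The theorem joins three independent facts.

  The progression contains infinitely many primes because \<open>269363\<close> is coprime to
  \<open>471240 = 8 \<cdot> 9 \<cdot> 5 \<cdot> 7 \<cdot> 11 \<cdot> 17\<close> and Dirichlet's theorem holds
  (\<open>infinite_primes_in_residue_class\<close>, for every modulus \<open>m\<close>). As \<open>269363\<close> is congruent to \<open>2\<close> modulo \<open>9\<close>,
  its square is not \<open>1\<close> modulo \<open>m\<close>, so by a theorem of Murty no Euclidean argument with values of a single polynomial is
  possible, and the characters modulo \<open>m\<close> are used. The proof compares finite sums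
  only: with \<open>\<Lambda>\<close> the von Mangoldt function, the sum
  \<open>S(\<psi>, x) = \<Sum>n\<le>x. \<psi>(n) \<Lambda>(n) / n\<close> is \<open>ln x + O(1)\<close> for the principal
  character (Mertens), and for another character it is \<open>O(1)\<close> or \<open>- ln x + O(1)\<close>
  according to whether \<open>L(1,\<psi>)\<close> differs from \<open>0\<close> or not. Summed over all characters, \<open>S(\<psi>, x)\<close> is a
  nonnegative multiple of \<open>\<Sum>n\<le>x, n \<equiv> 1. \<Lambda>(n) / n\<close>, so at most one \<open>L(1,\<psi>)\<close>
  vanishes. A nonreal \<open>\<psi>\<close> would vanish together with its conjugate, and a real one
  does not vanish by an argument of Monsky with Lambert series
  (\<open>L_one_real_char_nonzero\<close>). Hence no \<open>L(1,\<psi>)\<close> vanishes, and orthogonality isolates any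
  residue class coprime to \<open>m\<close>, on which \<open>\<Sum> \<Lambda>(n) / n\<close> diverges; proper prime
  powers contribute a bounded amount, so infinitely many primes remain.

  The permutation \<open>F_M\<close> is APN for a geometric reason. A generator \<open>R\<close> of a Singer
  group has no fixed point on the projective line, since a matrix with an eigenvector
  satisfies \<open>R^q = 1\<close> or \<open>R^q = R\<close> projectively; hence \<open>i \<mapsto> R^i P_0\<close> identifies
  the residues modulo \<open>q + 1\<close> with the points, and \<open>F_M\<close> with the action of \<open>M\<close>. The
  equation \<open>F_M(x + u) - F_M(x) = v\<close> says that the point \<open>R^x P_0\<close> is fixed by
  \<open>M\<^sup>-\<^sup>1 R\<^sup>-\<^sup>v M R\<^sup>u\<close>. A nontrivial element of \<open>PGL\<^sub>2\<close> fixes at most two points, so three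
  solutions force \<open>M R\<^sup>u = R\<^sup>v M\<close>. Lifted to matrices, \<open>R\<^sup>u\<close> and \<open>R\<^sup>v\<close> are affine in a
  traceless lift of \<open>J\<close>, and conjugation by \<open>M\<close> respects traceless parts; thus \<open>M\<close>
  commutes with \<open>J\<close>, which is excluded (\<open>derivative_three_solutions\<close>). Two solutions do occur
  for \<open>u = 1\<close>, by the pigeonhole principle.

  The remaining claims are congruences: \<open>n + 1\<close> is divisible by \<open>5\<close> and \<open>17\<close>,
  \<open>n + 3\<close> by \<open>3\<close> and \<open>7\<close>, \<open>n + 4\<close> by \<open>2\<close> and \<open>11\<close>, while \<open>n + 2\<close> is even,
  larger than \<open>2\<close> and not divisible by \<open>4\<close>.
\<close>

section \<open>Chebyshev and Mertens estimates\<close>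

text \<open>Dirichlet's rearrangement: every divisor sum below is evaluated by writing
  \<open>n = d k\<close> and grouping by \<open>d\<close>.\<close>

lemma sum_divisors_swap:
  fixes h :: "nat \<Rightarrow> nat \<Rightarrow> 'a::comm_monoid_add"
  shows "(\<Sum>n=1..x. \<Sum>d | d dvd n. h d (n div d)) = (\<Sum>d=1..x. \<Sum>k=1..x div d. h d k)"
proof -
  have "(\<Sum>n=1..x. \<Sum>d | d dvd n. h d (n div d))
        = (\<Sum>(n,d)\<in>(SIGMA n:{1..x}. {d. d dvd n}). h d (n div d))"
    by (rule sum.Sigma) auto
  also have "\<dots> = (\<Sum>(d,k)\<in>(SIGMA d:{1..x}. {1..x div d}). h d k)"
  proof (rule sum.reindex_bij_witness[where i = "\<lambda>(d,k). (d*k,d)" and j = "\<lambda>(n,d). (d,n div d)"],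
      goal_cases)
    case (2 a)
    then obtain n d where a: "a = (n,d)" "1 \<le> n" "n \<le> x" "d dvd n" by auto
    then have "1 \<le> d" "d \<le> n" by (auto intro: dvd_imp_le simp: Suc_le_eq dvd_pos_nat)
    moreover have "1 \<le> n div d" using a calculation by (simp add: Suc_le_eq div_greater_zero_iff)
    ultimately show ?case using a by (auto intro: div_le_mono)
  next
    case (4 b)
    then obtain d k where b: "b = (d,k)" "1 \<le> d" "d \<le> x" "1 \<le> k" "k \<le> x div d" by auto
    then have "d * k \<le> x" by (metis less_eq_div_iff_mult_less_eq mult.commute not_one_le_zero not_gr_zero)
    then show ?case using b by auto
  qed auto
  also have "\<dots> = (\<Sum>d=1..x. \<Sum>k=1..x div d. h d k)"
    by (rule sum.Sigma [symmetric]) auto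
  finally show ?thesis .
qed

lemma ln_fact_eq_sum: "ln (fact x :: real) = (\<Sum>n=1..x. ln (real n))"
  by (induction x) (simp_all add: ln_mult add.commute)

lemma sum_mangoldt_times_div: "(\<Sum>d=1..x. mangoldt d * real (x div d)) = ln (fact x)"
proof -
  have "(\<Sum>d=1..x. mangoldt d * real (x div d)) = (\<Sum>d=1..x. \<Sum>k=1..x div d. mangoldt d)"
    by (simp add: mult.commute)
  also have "\<dots> = (\<Sum>n=1..x. \<Sum>d | d dvd n. mangoldt d)"
    by (rule sum_divisors_swap [where h = "\<lambda>d k. mangoldt d", symmetric])
  also have "\<dots> = (\<Sum>n=1..x. ln (real n))"
    by (rule sum.cong) (use mangoldt_sum[where 'a = real] in auto)
  finally show ?thesis by (simp add: ln_fact_eq_sum)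
qed

lemma mult_ln_Suc_diff_le: "x > 0 \<Longrightarrow> real x * (ln (real (Suc x)) - ln (real x)) \<le> 1"
proof -
  assume "x > 0"
  then have x: "real x > 0" by simp
  then have "1 + 1 / real x = real (Suc x) / real x" by (simp add: field_simps)
  then have "real x * (ln (real (Suc x)) - ln (real x)) = real x * ln (1 + 1 / real x)"
    using x ln_div[of "real (Suc x)" "real x"] by simp
  also have "\<dots> \<le> real x * (1 / real x)"
    by (intro mult_left_mono ln_add_one_self_le_self) auto
  finally show ?thesis using x by simp
qed

text \<open>A weak form of Stirling's formula; \<open>ln (fact x)\<close> is the main term of all the
  estimates for \<open>\<Lambda>\<close>.\<close>

lemma ln_fact_ge: "x \<ge> 1 \<Longrightarrow> real x * ln (real x) - real x \<le> ln (fact x)"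
proof (induction x)
  case (Suc x)
  show ?case
  proof (cases "x = 0")
    case False
    then have "real x * (ln (real (Suc x)) - ln (real x)) \<le> 1" by (intro mult_ln_Suc_diff_le) simp
    moreover have "ln (fact (Suc x) :: real) = ln (real (Suc x)) + ln (fact x)"
      by (simp add: ln_mult)
    ultimately show ?thesis using Suc False by (simp add: algebra_simps)
  qed auto
qed auto

lemma ln_fact_le: "x \<ge> 1 \<Longrightarrow> ln (fact x) \<le> real x * ln (real x)"
proof -
  assume "x \<ge> 1"
  have "(\<Sum>n=1..x. ln (real n)) \<le> (\<Sum>n=1..x. ln (real x))"
    by (rule sum_mono) auto
  then show ?thesis by (simp add: ln_fact_eq_sum)
qed

text \<open>Chebyshev's trick: in \<open>ln (fact (2y)) - 2 ln (fact y)\<close> the coefficient of \<open>\<Lambda>(d)\<close> is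
  \<open>\<lfloor>2y/d\<rfloor> - 2\<lfloor>y/d\<rfloor>\<close>, which is nonnegative always and positive for \<open>y < d \<le> 2y\<close>,
  whereas the whole expression is the logarithm of a central binomial coefficient.\<close>

lemma sum_mangoldt_dyadic: "(\<Sum>d=y+1..2*y. mangoldt d :: real) \<le> 2 * real y * ln 2"
proof -
  let ?M = "mangoldt :: nat \<Rightarrow> real"
  have split: "{1..2*y} = {1..y} \<union> {y+1..2*y}" by auto
  have "(\<Sum>d=1..2*y. ?M d * real (y div d)) = (\<Sum>d=1..y. ?M d * real (y div d))"
    by (rule sum.mono_neutral_right) auto
  then have e: "(\<Sum>d=1..2*y. ?M d * (real (2*y div d) - 2 * real (y div d)))
     = ln (fact (2*y)) - 2 * ln (fact y)"
    using sum_mangoldt_times_div[of "2*y"] sum_mangoldt_times_div[of y]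
    by (simp add: right_diff_distrib sum_subtractf mult.left_commute[of _ 2]
        sum_distrib_left [symmetric] del: One_nat_def)
  have nonneg: "real (2*y div d) - 2 * real (y div d) \<ge> 0" for d
  proof (cases "d = 0")
    case False
    have "2 * (y div d) * d \<le> 2 * y" by (metis div_times_less_eq_dividend mult.assoc mult_le_mono2)
    then have "2 * (y div d) \<le> 2*y div d"
      using False by (simp add: less_eq_div_iff_mult_less_eq)
    then show ?thesis by linarith
  qed auto
  have "(\<Sum>d=y+1..2*y. ?M d) \<le> (\<Sum>d=y+1..2*y. ?M d * (real (2*y div d) - 2 * real (y div d)))"
  proof (rule sum_mono)
    fix d assume d: "d \<in> {y+1..2*y}"
    then have "y div d = 0" "2*y div d \<ge> 1" by (auto simp: Suc_le_eq div_greater_zero_iff)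
    then show "?M d \<le> ?M d * (real (2*y div d) - 2 * real (y div d))"
      using mangoldt_nonneg[of d] by (simp add: mult_le_cancel_left1)
  qed
  also have "\<dots> \<le> (\<Sum>d=1..2*y. ?M d * (real (2*y div d) - 2 * real (y div d)))"
    by (rule sum_mono2) (auto intro!: mult_nonneg_nonneg mangoldt_nonneg nonneg simp del: of_nat_mult)
  also have "\<dots> = ln (real ((2*y) choose y))"
    unfolding e by (simp add: binomial_fact ln_div ln_mult)
  also have "\<dots> \<le> ln (2 ^ (2*y))"
  proof -
    have "real ((2*y) choose y) \<le> real (2 ^ (2*y))"
      by (subst of_nat_le_iff) (rule binomial_le_pow2)
    moreover have "real ((2*y) choose y) > 0" by simp
    ultimately show ?thesis by (subst ln_le_cancel_iff) (auto simp del: power_mult)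
  qed
  also have "\<dots> = 2 * real y * ln 2" by (simp add: ln_realpow)
  finally show ?thesis .
qed

text \<open>Dyadic summation. The constant \<open>4\<close> leaves room for the term \<open>\<Lambda>(2y+1)\<close> that splits
  off when the range has odd length.\<close>

lemma sum_mangoldt_le: "(\<Sum>d=1..x. mangoldt d :: real) \<le> 4 * real x"
proof (induction x rule: less_induct)
  case (less x)
  let ?M = "mangoldt :: nat \<Rightarrow> real"
  consider "x = 0" | y where "x = 2*y" "y \<ge> 1" | y where "x = 2*y+1"
  proof (cases "even x")
    case True
    then obtain y where "x = 2*y" by (elim evenE)
    then show ?thesis using that(1) that(2)[of y] by (cases "y = 0") auto
  next
    case False
    then show ?thesis using that(3) by (elim oddE)
  qed
  then show ?case
  proof cases
    case (2 y)
    have "{1..x} = {1..y} \<union> {y+1..2*y}" using 2 by auto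
    then have "(\<Sum>d=1..x. ?M d) = (\<Sum>d=1..y. ?M d) + (\<Sum>d=y+1..2*y. ?M d)"
      by (simp add: sum.union_disjoint)
    moreover have "2 * real y * ln 2 \<le> 2 * real y * 1" using ln_2_less_1 by (intro mult_left_mono) auto
    moreover have "(\<Sum>d=1..y. ?M d) \<le> 4 * real y" "real x = 2 * real y" using less[of y] 2 by auto
    ultimately show ?thesis using sum_mangoldt_dyadic[of y] by linarith
  next
    case (3 y)
    have "{1..x} = insert x ({1..y} \<union> {y+1..2*y})" using 3 by auto
    then have "(\<Sum>d=1..x. ?M d) = ?M x + ((\<Sum>d=1..y. ?M d) + (\<Sum>d=y+1..2*y. ?M d))"
      using 3 by (simp add: sum.union_disjoint)
    moreover have "2 * real y * ln 2 \<le> 2 * real y * 1" using ln_2_less_1 by (intro mult_left_mono) auto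
    moreover have "?M x \<le> ln (real x)" using 3 by (intro mangoldt_le) auto
    moreover have "ln (real x) \<le> real x - 1" using 3 by (intro ln_le_minus_one) auto
    moreover have "(\<Sum>d=1..y. ?M d) \<le> 4 * real y" "real x = 2 * real y + 1" using less[of y] 3 by auto
    ultimately show ?thesis using sum_mangoldt_dyadic[of y] by linarith
  qed auto
qed

lemma of_nat_le_mult_Suc_div: "d > 0 \<Longrightarrow> real x \<le> real d * real (Suc (x div d))"
  by (metis less_imp_le of_nat_le_iff of_nat_mult dividend_less_times_div mult_Suc_right)

text \<open>Mertens: replacing \<open>\<lfloor>x/d\<rfloor>\<close> by \<open>x/d\<close> in \<open>\<Sum>d\<le>x. \<Lambda>(d) \<lfloor>x/d\<rfloor> = ln (fact x)\<close>
  costs at most \<open>\<Sum>d\<le>x. \<Lambda>(d)\<close>, which is linear in \<open>x\<close>.\<close>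

lemma mertens_upper:
  assumes "x \<ge> 1" shows "(\<Sum>d=1..x. mangoldt d / real d) \<le> ln (real x) + 4"
proof -
  have "real x * (\<Sum>d=1..x. mangoldt d / real d) = (\<Sum>d=1..x. mangoldt d * (real x / real d))"
    by (simp add: sum_distrib_left algebra_simps)
  also have "\<dots> \<le> (\<Sum>d=1..x. mangoldt d * (real (x div d) + 1))"
  proof (intro sum_mono mult_left_mono mangoldt_nonneg)
    fix d assume "d \<in> {1..x}"
    then show "real x / real d \<le> real (x div d) + 1"
      by (smt (verit) floor_divide_of_nat_eq of_int_of_nat_eq real_of_int_floor_add_one_ge)
  qed
  also have "\<dots> = ln (fact x) + (\<Sum>d=1..x. mangoldt d)"
    by (simp add: distrib_left sum.distrib sum_mangoldt_times_div del: One_nat_def)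
  also have "\<dots> \<le> real x * (ln (real x) + 4)"
    using ln_fact_le[OF assms] sum_mangoldt_le[of x] by (simp add: algebra_simps)
  finally show ?thesis using assms by simp
qed

lemma mertens_lower:
  assumes "x \<ge> 1" shows "ln (real x) - 1 \<le> (\<Sum>d=1..x. mangoldt d / real d)"
proof -
  have "real x * (ln (real x) - 1) \<le> ln (fact x)"
    using ln_fact_ge[OF assms] by (simp add: algebra_simps)
  also have "\<dots> = (\<Sum>d=1..x. mangoldt d * real (x div d))"
    by (rule sum_mangoldt_times_div [symmetric])
  also have "\<dots> \<le> (\<Sum>d=1..x. mangoldt d * (real x / real d))"
    by (intro sum_mono mult_left_mono mangoldt_nonneg of_nat_div_le_of_nat)
  also have "\<dots> = real x * (\<Sum>d=1..x. mangoldt d / real d)"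
    by (simp add: sum_distrib_left algebra_simps)
  finally show ?thesis using assms by simp
qed

section \<open>The Moebius function\<close>

definition moebius_mu :: "nat \<Rightarrow> real" where
  "moebius_mu n = (if squarefree n then (-1) ^ card (prime_factors n) else 0)"

lemma abs_moebius_mu_le: "\<bar>moebius_mu n\<bar> \<le> 1"
  by (simp add: moebius_mu_def)

lemma moebius_mu_1 [simp]: "moebius_mu (Suc 0) = 1"
  by (simp add: moebius_mu_def)

lemma moebius_mu_prime_mult:
  assumes "prime p"
  shows "moebius_mu (p * d) = (if p dvd d then 0 else - moebius_mu d)"
proof (cases "d = 0 \<or> p dvd d")
  case True
  then have "\<not> squarefree (p * d)"
    using assms by (auto simp: squarefree_def power2_eq_square intro!: exI[of _ p])
  then show ?thesis using True by (auto simp: moebius_mu_def)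
next
  case False
  then have "coprime p d" using assms by (simp add: prime_imp_coprime)
  then have "squarefree (p * d) \<longleftrightarrow> squarefree d"
    using assms squarefree_mult_coprime[of p d] squarefree_prime[of p] squarefree_mono[of d "p * d"]
    by auto
  moreover have "prime_factors (p * d) = insert p (prime_factors d)"
    using False assms by (subst prime_factors_product) (auto simp: prime_prime_factors)
  moreover have "p \<notin> prime_factors d" using False by auto
  ultimately show ?thesis using False by (simp add: moebius_mu_def)
qed

text \<open>Fix a prime \<open>p\<close> dividing \<open>n\<close>: among squarefree divisors, those prime to \<open>p\<close> and their
  multiples by \<open>p\<close> cancel in pairs.\<close>

lemma sum_moebius_mu:
  assumes "n > 0"
  shows "(\<Sum>d | d dvd n. moebius_mu d) = (if n = 1 then 1 else 0)"
proof (cases "n = 1")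
  case False
  then obtain p where p: "prime p" "p dvd n" by (metis prime_factor_nat)
  then obtain m where n: "n = p * m" by auto
  have fin: "finite {d. d dvd n}" using assms by simp
  let ?A = "{d. d dvd n \<and> \<not> p dvd d}" and ?B = "{d. d dvd n \<and> p dvd d}"
  have "(\<Sum>d | d dvd n. moebius_mu d) = sum moebius_mu ?A + sum moebius_mu ?B"
    by (subst sum.union_disjoint [symmetric]) (auto intro!: sum.cong finite_subset[OF _ fin])
  also have "sum moebius_mu ?B = (\<Sum>d | d dvd m. moebius_mu (p * d))"
    using p n by (intro sum.reindex_bij_witness[where i = "\<lambda>d. p * d" and j = "\<lambda>d. d div p"])
      (auto simp: prime_gt_0_nat)
  also have "\<dots> = (\<Sum>d | d dvd m \<and> \<not> p dvd d. - moebius_mu d)"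
    using p n assms by (intro sum.mono_neutral_cong_right) (auto simp: moebius_mu_prime_mult)
  also have "{d. d dvd m \<and> \<not> p dvd d} = ?A"
    using p n by (auto simp: coprime_dvd_mult_right_iff coprime_commute dest: prime_imp_coprime[OF p(1)])
  finally show ?thesis using False by (simp add: sum_negf)
qed simp

text \<open>Moebius inversion of \<open>mangoldt_sum\<close>, with \<open>ln (n / d)\<close> expanded as \<open>ln n - ln d\<close>.\<close>

lemma sum_moebius_mu_ln:
  assumes "n > 0"
  shows "(\<Sum>d | d dvd n. moebius_mu d * ln (real d)) = - mangoldt n"
proof -
  have fin: "finite {d. d dvd n}" using assms by simp
  have pos: "d dvd n \<Longrightarrow> d > 0 \<and> n div d > 0" for d
    using assms by (auto simp: dvd_pos_nat div_greater_zero_iff intro: dvd_imp_le)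
  have swap: "e dvd n \<and> d dvd n div e" if "d dvd n" "e dvd n div d" for d e
  proof -
    from that obtain k where "n = d * (e * k)" using assms by (auto elim!: dvdE split: if_splits)
    then show ?thesis using assms by (auto simp: mult.left_commute)
  qed
  have 1: "(\<Sum>e | e dvd n div d. mangoldt d * moebius_mu e) = (if d = n then mangoldt n else 0)"
    if "d dvd n" for d
    using sum_moebius_mu[of "n div d"] pos[OF that] that
    by (auto simp: sum_distrib_left [symmetric] elim!: dvdE split: if_splits)
  have 2: "(\<Sum>d | d dvd n div e. mangoldt d * moebius_mu e)
       = moebius_mu e * ln (real n) - moebius_mu e * ln (real e)" if "e dvd n" for e
    using mangoldt_sum[where 'a = real, of "n div e"] pos[OF that] that assms
    by (simp add: sum_distrib_right [symmetric] real_of_nat_div ln_div)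
      (simp add: algebra_simps sum_distrib_left [symmetric])
  have "mangoldt n = (\<Sum>d | d dvd n. \<Sum>e | e dvd n div d. mangoldt d * moebius_mu e)"
    using fin assms by (simp add: 1)
  also have "\<dots> = (\<Sum>(d,e)\<in>(SIGMA d:{d. d dvd n}. {e. e dvd n div d}). mangoldt d * moebius_mu e)"
    by (rule sum.Sigma) (use fin pos in auto)
  also have "\<dots> = (\<Sum>(e,d)\<in>(SIGMA e:{e. e dvd n}. {d. d dvd n div e}). mangoldt d * moebius_mu e)"
    by (rule sum.reindex_bij_witness[where i = "\<lambda>(a,b). (b,a)" and j = "\<lambda>(a,b). (b,a)"])
      (auto dest: swap)
  also have "\<dots> = (\<Sum>e | e dvd n. \<Sum>d | d dvd n div e. mangoldt d * moebius_mu e)"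
    by (rule sum.Sigma [symmetric]) (use fin pos in auto)
  also have "\<dots> = (\<Sum>e | e dvd n. moebius_mu e * ln (real n) - moebius_mu e * ln (real e))"
    by (rule sum.cong) (auto simp: 2)
  also have "\<dots> = ln (real n) * (\<Sum>e | e dvd n. moebius_mu e)
      - (\<Sum>e | e dvd n. moebius_mu e * ln (real e))"
    by (simp add: sum_subtractf sum_distrib_left mult.commute)
  finally show ?thesis using sum_moebius_mu[OF assms] by auto
qed

section \<open>Dirichlet characters and their orthogonality\<close>

text \<open>A character of a subgroup of the unit group modulo \<open>m\<close>. The subgroup is a set \<open>H\<close> of
  natural numbers closed under congruence, so that products need no reduction;
  closure under inverses follows from Euler's theorem.\<close>

definition partial_character :: "nat \<Rightarrow> nat set \<Rightarrow> (nat \<Rightarrow> complex) \<Rightarrow> bool" where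
  "partial_character m H f \<longleftrightarrow>
     (\<forall>a\<in>H. coprime a m) \<and> 1 \<in> H \<and> f 1 = 1 \<and>
     (\<forall>a\<in>H. \<forall>b. [a = b] (mod m) \<longrightarrow> b \<in> H \<and> f b = f a) \<and>
     (\<forall>a\<in>H. \<forall>b\<in>H. a * b \<in> H \<and> f (a * b) = f a * f b)"

lemma partial_characterD:
  assumes "partial_character m H f"
  shows "a \<in> H \<Longrightarrow> coprime a m" "1 \<in> H" "f 1 = 1"
    and "a \<in> H \<Longrightarrow> [a = b] (mod m) \<Longrightarrow> b \<in> H" "a \<in> H \<Longrightarrow> [a = b] (mod m) \<Longrightarrow> f b = f a"
    and "a \<in> H \<Longrightarrow> b \<in> H \<Longrightarrow> a * b \<in> H" "a \<in> H \<Longrightarrow> b \<in> H \<Longrightarrow> f (a * b) = f a * f b"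
  using assms unfolding partial_character_def by blast+

lemma partial_character_power:
  assumes "partial_character m H f" "a \<in> H"
  shows "a ^ i \<in> H \<and> f (a ^ i) = f a ^ i"
  using partial_characterD(2,3,6,7)[OF assms(1)] assms(2) by (induction i) auto

lemma partial_character_cancel:
  assumes "m > 0" "partial_character m H f" "a \<in> H" "a * b \<in> H"
  shows "b \<in> H"
proof -
  have "coprime a m" using assms partial_characterD(1) by blast
  then have "[a ^ totient m * b = 1 * b] (mod m)" by (intro cong_mult euler_theorem) auto
  moreover have "a ^ totient m * b = a ^ (totient m - 1) * (a * b)"
    using assms(1) totient_gt_0_iff[of m] by (cases "totient m") (auto simp: mult_ac)
  moreover have "a ^ (totient m - 1) * (a * b) \<in> H"
    using partial_characterD(6)[OF assms(2)] partial_character_power[OF assms(2,3)] assms(4) by blast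
  ultimately show ?thesis using partial_characterD(4)[OF assms(2)] by simp
qed

text \<open>A character of \<open>H\<close> extends to the subgroup generated by \<open>H\<close> and \<open>g\<close> by choosing the
  value \<open>c\<close> at \<open>g\<close> freely among the \<open>k\<close>-th roots of the prescribed value at \<open>g^k\<close>,
  where \<open>k\<close> is the order of \<open>g\<close> modulo \<open>H\<close>. The freedom in \<open>c\<close> is what makes
  characters separate points.\<close>

lemma partial_character_extend:
  assumes m: "m > 0" and f: "partial_character m H f" and g: "coprime g m"
    and k: "k > 0" "g ^ k \<in> H" "\<And>r. 0 < r \<Longrightarrow> r < k \<Longrightarrow> g ^ r \<notin> H" and c: "c ^ k = f (g ^ k)"
  obtains H' f' where "partial_character m H' f'" "H \<subseteq> H'" "g \<in> H'" "f' g = c"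
    "\<And>a. a \<in> H \<Longrightarrow> f' a = f a"
proof -
  note fD = partial_characterD[OF f]
  \<comment> \<open>the graph of the extension; \<open>uniq\<close> below shows that it is a function\<close>
  define R where "R = (\<lambda>a z. \<exists>i. \<exists>h\<in>H. [a = g ^ i * h] (mod m) \<and> z = c ^ i * f h)"
  have pow: "c ^ j = f (g ^ j)" if "g ^ j \<in> H" for j
  proof -
    have kq: "g ^ (k * q) \<in> H \<and> f (g ^ (k * q)) = c ^ (k * q)" for q
      using partial_character_power[OF f k(2), of q] c by (simp add: power_mult)
    have "g ^ (k * (j div k)) * g ^ (j mod k) \<in> H"
      using that by (simp flip: power_add)
    then have "g ^ (j mod k) \<in> H" using partial_character_cancel[OF m f] kq by blast
    then have "j mod k = 0" using k(1,3) by (metis mod_less_divisor not_gr_zero)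
    then have "j = k * (j div k)" by auto
    then show ?thesis using kq by metis
  qed
  have uniq_le: "c ^ i * f h = c ^ j * f h'"
    if "[g ^ i * h = g ^ j * h'] (mod m)" "h \<in> H" "h' \<in> H" "i \<le> j" for i j h h'
  proof -
    have "g ^ j = g ^ i * g ^ (j - i)" using that by (simp flip: power_add)
    then have "[g ^ i * h = g ^ i * (g ^ (j - i) * h')] (mod m)" using that by (simp add: mult_ac)
    then have e: "[h = g ^ (j - i) * h'] (mod m)" using g by (simp add: cong_mult_lcancel_nat coprime_power_left_iff)
    then have "h' * g ^ (j - i) \<in> H" using fD(4) that by (simp add: mult.commute)
    then have G: "g ^ (j - i) \<in> H" using partial_character_cancel[OF m f] that by blast
    then have "f h = c ^ (j - i) * f h'" using fD(5)[OF _ e] fD(7)[OF G] that pow[OF G] by simp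
    moreover have "c ^ j = c ^ i * c ^ (j - i)" using that by (simp flip: power_add)
    ultimately show ?thesis by (simp add: mult_ac)
  qed
  have uniq: "z = z'" if "R a z" "R b z'" "[a = b] (mod m)" for a b z z'
  proof -
    from that obtain i h j h' where "h \<in> H" "h' \<in> H" "[a = g ^ i * h] (mod m)" "z = c ^ i * f h"
      "[b = g ^ j * h'] (mod m)" "z' = c ^ j * f h'" unfolding R_def by blast
    moreover from calculation have "[g ^ i * h = g ^ j * h'] (mod m)"
      using that(3) by (metis cong_sym cong_trans)
    ultimately show ?thesis using uniq_le[of i h j h'] uniq_le[of j h' i h]
      by (metis cong_sym nat_le_linear)
  qed
  define H' where "H' = {a. \<exists>z. R a z}"
  define f' where "f' = (\<lambda>a. THE z. R a z)"
  have f'eq: "f' a = z" if "R a z" for a z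
    unfolding f'_def using that uniq by (intro the_equality) auto
  have f': "R a (f' a)" if "a \<in> H'" for a using that f'eq unfolding H'_def by force
  have RH: "R a (f a)" if "a \<in> H" for a
    unfolding R_def using that by (intro exI[of _ 0] bexI[of _ a]) auto
  have Rg: "R g c" unfolding R_def using fD(2,3) by (intro exI[of _ 1] bexI[of _ 1]) auto
  have Rmult: "R (a * b) (z * z')" if "R a z" "R b z'" for a b z z'
  proof -
    from that obtain i h j h' where *: "h \<in> H" "h' \<in> H" "[a = g ^ i * h] (mod m)" "z = c ^ i * f h"
      "[b = g ^ j * h'] (mod m)" "z' = c ^ j * f h'" unfolding R_def by blast
    have "[a * b = g ^ (i + j) * (h * h')] (mod m)"
      using cong_mult[OF *(3,5)] by (simp add: power_add mult_ac)
    moreover have "z * z' = c ^ (i + j) * f (h * h')"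
      using * fD(7) by (simp add: power_add mult_ac)
    ultimately show ?thesis unfolding R_def using fD(6) *(1,2) by blast
  qed
  have Rcong: "R b z" if "R a z" "[a = b] (mod m)" for a b z
    using that unfolding R_def by (meson cong_sym cong_trans)
  have "partial_character m H' f'"
    unfolding partial_character_def
  proof (intro conjI ballI allI impI)
    fix a assume "a \<in> H'"
    then obtain i h where "h \<in> H" "[a = g ^ i * h] (mod m)" unfolding H'_def R_def by blast
    then show "coprime a m" using g fD(1)
      by (metis cong_imp_coprime cong_sym coprime_mult_left_iff coprime_power_left_iff)
  next
    show "1 \<in> H'" "f' 1 = 1" using RH[OF fD(2)] f'eq fD(3) by (auto simp: H'_def)
  next
    fix a b assume "a \<in> H'" "[a = b] (mod m)"
    then have "R b (f' a)" using f' Rcong by blast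
    then show "b \<in> H'" "f' b = f' a" using f'eq by (auto simp: H'_def)
  next
    fix a b assume "a \<in> H'" "b \<in> H'"
    then have "R (a * b) (f' a * f' b)" using f' Rmult by blast
    then show "a * b \<in> H'" "f' (a * b) = f' a * f' b" using f'eq by (auto simp: H'_def)
  qed
  moreover have "H \<subseteq> H'" "g \<in> H'" using RH Rg by (auto simp: H'_def)
  moreover have "f' g = c" "\<And>a. a \<in> H \<Longrightarrow> f' a = f a" using f'eq RH Rg by auto
  ultimately show thesis using that by blast
qed

lemma least_power_in:
  assumes "m > 0" "partial_character m H f" "coprime g m"
  shows "\<exists>k>0. g ^ k \<in> H \<and> (\<forall>r. 0 < r \<longrightarrow> r < k \<longrightarrow> g ^ r \<notin> H)"
proof -
  have "[1 = g ^ totient m] (mod m)" using euler_theorem assms(3) cong_sym by blast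
  then have "g ^ totient m \<in> H" using partial_characterD(2,4)[OF assms(2)] by blast
  then have ex: "\<exists>k. k > 0 \<and> g ^ k \<in> H" using assms(1) totient_gt_0_iff by blast
  define k where "k = (LEAST k. k > 0 \<and> g ^ k \<in> H)"
  have "k > 0 \<and> g ^ k \<in> H" unfolding k_def using ex by (rule LeastI_ex)
  moreover have "g ^ r \<notin> H" if "0 < r" "r < k" for r
    using not_less_Least[of r] that unfolding k_def by blast
  ultimately show ?thesis by blast
qed

lemma ex_nth_root_complex:
  fixes z :: complex assumes "k > 0" shows "\<exists>c. c ^ k = z"
proof (cases "z = 0")
  case False
  then have "card {c. c ^ k = z} > 0" using card_nth_roots[OF False assms] assms by simp
  then show ?thesis by (auto simp: card_gt_0_iff)
next
  case True
  then have "0 ^ k = z" using assms by simp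
  then show ?thesis by (rule exI)
qed

text \<open>The locale describes Dirichlet characters as functions on the natural numbers, extended
  by \<open>0\<close> to arguments that are not coprime to the modulus.\<close>

locale dirichlet_char =
  fixes m :: nat and \<psi> :: "nat \<Rightarrow> complex"
  assumes modulus_pos: "m > 0"
    and mult: "\<psi> (a * b) = \<psi> a * \<psi> b"
    and mod: "\<psi> (a mod m) = \<psi> a"
    and eq_0_iff: "\<psi> a = 0 \<longleftrightarrow> \<not> coprime a m"
begin

lemma one [simp]: "\<psi> (Suc 0) = 1" "\<psi> 1 = 1"
proof -
  show "\<psi> 1 = 1" using mult[of 1 1] eq_0_iff[of 1] by auto
  then show "\<psi> (Suc 0) = 1" by simp
qed

lemma cong: "[a = b] (mod m) \<Longrightarrow> \<psi> a = \<psi> b"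
  using mod[of a] mod[of b] by (simp add: cong_def)

lemma power: "\<psi> (a ^ k) = \<psi> a ^ k"
  by (induction k) (simp_all add: mult)

lemma norm_eq_1: "coprime a m \<Longrightarrow> norm (\<psi> a) = 1"
proof -
  assume "coprime a m"
  then have "\<psi> a ^ totient m = 1" using cong[OF euler_theorem] by (simp add: power)
  then show ?thesis using modulus_pos power_eq_1_iff[of "\<psi> a" "totient m"] by auto
qed

lemma norm_le_1: "norm (\<psi> a) \<le> 1"
  using norm_eq_1[of a] eq_0_iff[of a] by (cases "coprime a m") auto

end

text \<open>Each adjunction of a generator strictly enlarges the subgroup, so finitely many steps
  reach the full unit group.\<close>

lemma extend_to_dirichlet_char:
  assumes "m > 0" "partial_character m H f"
  shows "\<exists>\<psi>. dirichlet_char m \<psi> \<and> (\<forall>a\<in>H. \<psi> a = f a)"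
  using assms(2)
proof (induction "card ({..<m} - H)" arbitrary: H f rule: less_induct)
  case less
  note fD = partial_characterD[OF less.prems]
  show ?case
  proof (cases "\<exists>g. coprime g m \<and> g \<notin> H")
    case True
    then obtain g where g: "coprime g m" "g \<notin> H" by blast
    obtain k where k: "k > 0" "g ^ k \<in> H" "\<And>r. 0 < r \<Longrightarrow> r < k \<Longrightarrow> g ^ r \<notin> H"
      using least_power_in[OF assms(1) less.prems g(1)] by blast
    obtain c where "c ^ k = f (g ^ k)" using ex_nth_root_complex k(1) by blast
    then obtain H' f' where H': "partial_character m H' f'" "H \<subseteq> H'" "g \<in> H'"
      "\<And>a. a \<in> H \<Longrightarrow> f' a = f a"
      using partial_character_extend[OF assms(1) less.prems g(1) k] by metis
    have "[g = g mod m] (mod m)" by (simp add: cong_def)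
    then have "g mod m \<in> H'" "g mod m \<notin> H"
      using H' g(2) partial_characterD(4)[OF H'(1)] fD(4) cong_sym by blast+
    then have "{..<m} - H' \<subset> {..<m} - H" using H'(2) assms(1) by (auto simp: psubset_eq)
    then have "card ({..<m} - H') < card ({..<m} - H)" by (intro psubset_card_mono) auto
    then show ?thesis using less.hyps[OF _ H'(1)] H'(2,4) by (metis subsetD)
  next
    case False
    then have H: "H = {a. coprime a m}" using fD(1) by blast
    define \<psi> where "\<psi> = (\<lambda>a. if coprime a m then f a else 0)"
    have nz: "f a \<noteq> 0" if "coprime a m" for a
    proof
      assume "f a = 0"
      moreover have "f (a ^ totient m) = 1"
        using fD(3) fD(5)[OF fD(2) cong_sym[OF euler_theorem[OF that]]] by simp
      ultimately show False using partial_character_power[OF less.prems, of a "totient m"] that H assms(1)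
        by (simp add: power_0_left split: if_splits)
    qed
    have "dirichlet_char m \<psi>"
    proof
      fix a b
      show "\<psi> (a * b) = \<psi> a * \<psi> b" using fD(7) H by (simp add: \<psi>_def)
      have "f (a mod m) = f a" if "coprime a m"
        using fD(5)[of a "a mod m"] that H by (simp add: cong_def)
      then show "\<psi> (a mod m) = \<psi> a" by (simp add: \<psi>_def coprime_mod_left_iff assms(1))
      show "\<psi> a = 0 \<longleftrightarrow> \<not> coprime a m" using nz by (simp add: \<psi>_def)
    qed (use assms in auto)
    then show ?thesis using H by (auto simp: \<psi>_def)
  qed
qed

text \<open>Start from the trivial subgroup and give \<open>a\<close> a primitive root of unity of the order of
  \<open>a\<close> as its value.\<close>

lemma ex_dirichlet_char_neq_1:
  assumes "m > 0" "coprime a m" "\<not> [a = 1] (mod m)"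
  shows "\<exists>\<psi>. dirichlet_char m \<psi> \<and> \<psi> a \<noteq> 1"
proof -
  let ?H = "{b. [b = 1] (mod m)}"
  have triv: "partial_character m ?H (\<lambda>_. 1)"
    unfolding partial_character_def
  proof (intro conjI ballI allI impI)
    fix b assume "b \<in> ?H"
    then show "coprime b m" by (metis cong_imp_coprime cong_sym coprime_1_left mem_Collect_eq)
  next
    fix b c assume "b \<in> ?H" "c \<in> ?H"
    then show "b * c \<in> ?H" using cong_mult[of b 1 m c 1] by simp
  next
    fix b c assume "b \<in> ?H" "[b = c] (mod m)"
    then show "c \<in> ?H" by (metis cong_sym cong_trans mem_Collect_eq)
  qed auto
  obtain k where k: "k > 0" "a ^ k \<in> ?H" "\<And>r. 0 < r \<Longrightarrow> r < k \<Longrightarrow> a ^ r \<notin> ?H"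
    using least_power_in[OF assms(1) triv assms(2)] by blast
  have "k \<noteq> 1" using k(2) assms(3) by auto
  then have k2: "k > 1" using k(1) by simp
  define c where "c = cis (2 * pi / real k)"
  have "c ^ k = 1" using k(1) by (simp add: c_def DeMoivre)
  moreover have "c \<noteq> 1"
  proof
    assume "c = 1"
    then have "cis (2 * pi * real 1 / real k) = cis (2 * pi * real 0 / real k)" by (simp add: c_def)
    then show False using k2 inj_onD[OF bij_betw_imp_inj_on[OF bij_betw_roots_unity[OF k(1)]], of 1 0] by auto
  qed
  ultimately show ?thesis
    using partial_character_extend[OF assms(1) triv assms(2) k] extend_to_dirichlet_char[OF assms(1)]
    by metis
qed

definition dirichlet_chars :: "nat \<Rightarrow> (nat \<Rightarrow> complex) set" where
  "dirichlet_chars m = {\<psi>. dirichlet_char m \<psi>}"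

definition principal_char :: "nat \<Rightarrow> nat \<Rightarrow> complex" where
  "principal_char m a = (if coprime a m then 1 else 0)"

lemma dirichlet_char_principal: "m > 0 \<Longrightarrow> dirichlet_char m (principal_char m)"
  by unfold_locales (auto simp: principal_char_def coprime_mod_left_iff)

lemma dirichlet_char_cnj:
  assumes "dirichlet_char m \<psi>" shows "dirichlet_char m (\<lambda>a. cnj (\<psi> a))"
proof -
  interpret dirichlet_char m \<psi> by fact
  show ?thesis by unfold_locales (auto simp: modulus_pos mult mod eq_0_iff)
qed

lemma dirichlet_char_mult:
  assumes "dirichlet_char m \<psi>" "dirichlet_char m \<omega>" shows "dirichlet_char m (\<lambda>a. \<psi> a * \<omega> a)"
proof -
  interpret A: dirichlet_char m \<psi> by fact
  interpret B: dirichlet_char m \<omega> by fact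
  show ?thesis
    by unfold_locales (auto simp: A.modulus_pos A.mult A.mod A.eq_0_iff B.mult B.mod B.eq_0_iff)
qed

text \<open>A character is determined by its values on \<open>{..<m}\<close>, each of which is \<open>0\<close> or a root of
  unity of order dividing \<open>totient m\<close>.\<close>

lemma finite_dirichlet_chars:
  assumes "m > 0" shows "finite (dirichlet_chars m)"
proof -
  let ?R = "insert 0 {z::complex. z ^ totient m = 1}"
  have "finite ?R" using finite_roots_unity[of "totient m"] assms by (simp add: Suc_le_eq)
  then have "finite (PiE {..<m} (\<lambda>_. ?R))" by (intro finite_PiE) auto
  moreover have "(\<lambda>\<psi>. restrict \<psi> {..<m}) ` dirichlet_chars m \<subseteq> PiE {..<m} (\<lambda>_. ?R)"
  proof (intro image_subsetI PiE_I)
    fix \<psi> a assume "\<psi> \<in> dirichlet_chars m" "a \<in> {..<m}"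
    then interpret dirichlet_char m \<psi> by (simp add: dirichlet_chars_def)
    show "restrict \<psi> {..<m} a \<in> ?R"
      using \<open>a \<in> {..<m}\<close> eq_0_iff[of a] cong[OF euler_theorem, of a] by (auto simp: power)
  qed auto
  moreover have "inj_on (\<lambda>\<psi>. restrict \<psi> {..<m}) (dirichlet_chars m)"
  proof (intro inj_onI ext)
    fix \<psi> \<omega> a
    assume *: "\<psi> \<in> dirichlet_chars m" "\<omega> \<in> dirichlet_chars m" "restrict \<psi> {..<m} = restrict \<omega> {..<m}"
    then have "\<psi> (a mod m) = \<omega> (a mod m)"
      using assms by (metis lessThan_iff mod_less_divisor restrict_apply')
    then show "\<psi> a = \<omega> a" using * by (simp add: dirichlet_chars_def dirichlet_char.mod)
  qed
  ultimately show ?thesis by (meson finite_imageD finite_subset)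
qed

text \<open>Multiplication by a character \<open>\<omega>\<close> with \<open>\<omega> a \<noteq> 1\<close> permutes the characters and
  multiplies the sum by \<open>\<omega> a\<close>.\<close>

lemma sum_dirichlet_chars:
  assumes "m > 0"
  shows "(\<Sum>\<psi>\<in>dirichlet_chars m. \<psi> a) = (if [a = 1] (mod m) then of_nat (card (dirichlet_chars m)) else 0)"
proof -
  consider "[a = 1] (mod m)" | "\<not> coprime a m" "\<not> [a = 1] (mod m)" | "coprime a m" "\<not> [a = 1] (mod m)"
    by blast
  then show ?thesis
  proof cases
    case 1
    then have "\<psi> a = 1" if "\<psi> \<in> dirichlet_chars m" for \<psi>
      using that dirichlet_char.cong[of m \<psi> a 1] by (simp add: dirichlet_chars_def dirichlet_char.one)
    then have "(\<Sum>\<psi>\<in>dirichlet_chars m. \<psi> a) = (\<Sum>\<psi>\<in>dirichlet_chars m. 1)" by (intro sum.cong) auto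
    then show ?thesis using 1 by simp
  next
    case 2
    then have "\<psi> a = 0" if "\<psi> \<in> dirichlet_chars m" for \<psi>
      using that by (simp add: dirichlet_chars_def dirichlet_char.eq_0_iff)
    then have "(\<Sum>\<psi>\<in>dirichlet_chars m. \<psi> a) = 0" by (intro sum.neutral) auto
    then show ?thesis using 2 by simp
  next
    case 3
    then obtain \<omega> where \<omega>: "dirichlet_char m \<omega>" "\<omega> a \<noteq> 1"
      using ex_dirichlet_char_neq_1 assms by blast
    interpret dirichlet_char m \<omega> by fact
    have unit: "\<omega> b * (cnj (\<omega> b) * \<psi> b) = \<psi> b" if "dirichlet_char m \<psi>" for b \<psi>
      using norm_eq_1[of b] dirichlet_char.eq_0_iff[OF that, of b]
      by (cases "coprime b m") (auto simp: complex_norm_square[symmetric] mult.assoc[symmetric])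
    have "(\<Sum>\<psi>\<in>dirichlet_chars m. \<omega> a * \<psi> a) = (\<Sum>\<psi>\<in>dirichlet_chars m. \<psi> a)"
      by (rule sum.reindex_bij_witness[where i = "\<lambda>\<psi> b. cnj (\<omega> b) * \<psi> b" and j = "\<lambda>\<psi> b. \<omega> b * \<psi> b"])
        (auto simp: dirichlet_chars_def unit dirichlet_char_mult dirichlet_char_cnj \<omega> mult.left_commute[of "cnj _"])
    then have "\<omega> a * (\<Sum>\<psi>\<in>dirichlet_chars m. \<psi> a) = (\<Sum>\<psi>\<in>dirichlet_chars m. \<psi> a)"
      by (simp add: sum_distrib_left)
    then show ?thesis using \<omega>(2) 3 by simp
  qed
qed

section \<open>The value of an L-series at one\<close>

locale nonprincipal_char = dirichlet_char +
  assumes nonprincipal: "\<psi> \<noteq> principal_char m"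
begin

lemma sum_period: "(\<Sum>a<m. \<psi> a) = 0"
proof -
  obtain b where "\<psi> b \<noteq> principal_char m b" using nonprincipal by blast
  then have b: "coprime b m" "\<psi> b \<noteq> 1" using eq_0_iff[of b] by (auto simp: principal_char_def split: if_splits)
  obtain b' where b': "[b * b' = 1] (mod m)" using b(1) using cong_solve_coprime_nat by auto
  have *: "b * (b' * a mod m) mod m = a" "b' * (b * a mod m) mod m = a" if "a < m" for a
    using cong_mult[OF b' cong_refl[of a]] that by (auto simp: cong_def mod_mult_right_eq mult_ac)
  have "(\<Sum>a<m. \<psi> b * \<psi> a) = (\<Sum>a<m. \<psi> a)"
    by (rule sum.reindex_bij_witness[where i = "\<lambda>a. b' * a mod m" and j = "\<lambda>a. b * a mod m"])
      (auto simp: * modulus_pos mult mod)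
  then have "\<psi> b * (\<Sum>a<m. \<psi> a) = (\<Sum>a<m. \<psi> a)" by (simp add: sum_distrib_left)
  then show ?thesis using b(2) by simp
qed

lemma norm_sum_lessThan_le: "norm (\<Sum>a<n. \<psi> a) \<le> real m"
proof (induction n rule: less_induct)
  case (less n)
  show ?case
  proof (cases "n \<le> m")
    case True
    have "norm (\<Sum>a<n. \<psi> a) \<le> (\<Sum>a<n. 1)" by (intro sum_norm_le norm_le_1)
    then show ?thesis using True by simp
  next
    case False
    then obtain k where k: "n = m + k" "k < n" using modulus_pos that[of "n - m"] by simp
    have "(\<Sum>a<n. \<psi> a) = (\<Sum>a<m. \<psi> a) + (\<Sum>a<k. \<psi> (m + a))"
      using sum.atLeastLessThan_concat[of 0 m "m + k" \<psi>] sum.shift_bounds_nat_ivl[of \<psi> 0 m k]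
      unfolding k(1) by (simp add: atLeast0LessThan add.commute)
    also have "(\<Sum>a<k. \<psi> (m + a)) = (\<Sum>a<k. \<psi> a)" by (intro sum.cong cong) (auto simp: cong_def)
    finally show ?thesis using less[OF k(2)] sum_period by simp
  qed
qed

lemma norm_sum_atLeastLessThan_le: "norm (\<Sum>a=k..<n. \<psi> a) \<le> 2 * real m"
proof (cases "k \<le> n")
  case True
  then have "(\<Sum>a=k..<n. \<psi> a) = (\<Sum>a<n. \<psi> a) - (\<Sum>a<k. \<psi> a)"
    by (metis atLeast0LessThan sum_diff_nat_ivl zero_le)
  then show ?thesis using norm_sum_lessThan_le[of n] norm_sum_lessThan_le[of k]
      norm_triangle_ineq4[of "\<Sum>a<n. \<psi> a" "\<Sum>a<k. \<psi> a"] by simp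
qed auto

end

text \<open>Abel summation: bounded partial sums against decreasing nonnegative weights.\<close>

lemma norm_sum_mult_antimono_le:
  fixes g :: "nat \<Rightarrow> complex" and f :: "nat \<Rightarrow> real"
  assumes B: "\<And>n. norm (\<Sum>k=a..<n. g k) \<le> B"
    and dec: "\<And>n. a \<le> n \<Longrightarrow> f (Suc n) \<le> f n" and nonneg: "\<And>n. a \<le> n \<Longrightarrow> f n \<ge> 0"
  shows "norm (\<Sum>k=a..<b. g k * of_real (f k)) \<le> B * f a"
proof (cases "a \<le> b")
  case True
  define G where "G = (\<lambda>n. \<Sum>k=a..<n. g k)"
  have "(\<Sum>k=a..<b. g k * of_real (f k)) = G b * f b + (\<Sum>k=a..<b. G (Suc k) * of_real (f k - f (Suc k)))"
    using True
  proof (induction b rule: dec_induct)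
    case (step n)
    then have "G (Suc n) = G n + g n" by (simp add: G_def)
    then show ?case using step by (simp add: algebra_simps)
  qed (simp add: G_def)
  also have "norm \<dots> \<le> B * f b + (\<Sum>k=a..<b. B * (f k - f (Suc k)))"
    using B dec nonneg True
    by (intro order.trans[OF norm_triangle_ineq] add_mono sum_norm_le)
      (auto simp: norm_mult G_def simp del: of_real_diff sum.op_ivl_Suc intro!: mult_right_mono)
  also have "(\<Sum>k=a..<b. f k - f (Suc k)) = f a - f b"
    using True by (induction b rule: dec_induct) auto
  then have "(\<Sum>k=a..<b. B * (f k - f (Suc k))) = B * (f a - f b)"
    by (simp flip: sum_distrib_left)
  finally show ?thesis by (simp add: algebra_simps)
next
  case False
  have "B \<ge> 0" using B[of a] by simp
  then show ?thesis using False nonneg[of a] by simp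
qed

text \<open>The function \<open>ln t / t\<close> decreases from \<open>e\<close> on; \<open>3\<close> is the first integer beyond it.\<close>

lemma ln_over_self_antimono:
  assumes "3 \<le> n" shows "ln (real (Suc n)) / real (Suc n) \<le> ln (real n) / real n"
proof -
  have "1 \<le> ln (3::real)" using exp_le by (simp add: ln_ge_iff)
  also have "\<dots> \<le> ln (real n)" using assms by simp
  finally have 1: "1 \<le> ln (real n)" .
  have "real n * (ln (real (Suc n)) - ln (real n)) \<le> 1" using assms by (intro mult_ln_Suc_diff_le) simp
  then have "real n * ln (real (Suc n)) \<le> real (Suc n) * ln (real n)"
    using 1 by (simp add: algebra_simps)
  then show ?thesis using assms by (simp add: field_simps)
qed

definition char_sum :: "(nat \<Rightarrow> complex) \<Rightarrow> nat \<Rightarrow> complex" where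
  "char_sum \<psi> x = (\<Sum>k=1..x. \<psi> k / of_nat k)"

text \<open>The value at \<open>1\<close> of the L-series of \<open>\<psi>\<close>, as the limit of the conditionally convergent
  series; \<open>char_sum_tendsto\<close> shows that the limit exists for nonprincipal characters.\<close>

definition L_one :: "(nat \<Rightarrow> complex) \<Rightarrow> complex" where
  "L_one \<psi> = lim (char_sum \<psi>)"

definition mangoldt_char_sum :: "(nat \<Rightarrow> complex) \<Rightarrow> nat \<Rightarrow> complex" where
  "mangoldt_char_sum \<psi> x = (\<Sum>n=1..x. \<psi> n * of_real (mangoldt n / real n))"

context nonprincipal_char
begin

lemma norm_char_sum_diff_le:
  assumes "y \<le> z" shows "norm (char_sum \<psi> z - char_sum \<psi> y) \<le> 2 * real m / real (Suc y)"
proof -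
  have "{1..z} = {1..y} \<union> {Suc y..<Suc z}" using assms by auto
  then have "char_sum \<psi> z = char_sum \<psi> y + (\<Sum>k=Suc y..<Suc z. \<psi> k / of_nat k)"
    unfolding char_sum_def by (simp only:) (subst sum.union_disjoint, auto)
  then have "char_sum \<psi> z - char_sum \<psi> y = (\<Sum>k=Suc y..<Suc z. \<psi> k * of_real (1 / real k))"
    by simp
  also have "norm \<dots> \<le> 2 * real m * (1 / real (Suc y))"
    by (rule norm_sum_mult_antimono_le[OF norm_sum_atLeastLessThan_le]) (auto simp: field_simps)
  finally show ?thesis by simp
qed

lemma char_sum_tendsto: "char_sum \<psi> \<longlonglongrightarrow> L_one \<psi>"
proof -
  have "Cauchy (char_sum \<psi>)"
  proof (rule CauchyI')
    fix e :: real assume e: "e > 0"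
    obtain M where M: "2 * real m / e < real M" using reals_Archimedean2 by blast
    have "dist (char_sum \<psi> y) (char_sum \<psi> z) < e" if "M \<le> y" "y < z" for y z
    proof -
      have "dist (char_sum \<psi> y) (char_sum \<psi> z) \<le> 2 * real m / real (Suc y)"
        using norm_char_sum_diff_le[of y z] that by (simp add: dist_norm norm_minus_commute)
      also have "\<dots> < e"
      proof -
        have "2 * real m / e < real (Suc y)" using M that by linarith
        then show ?thesis using e by (simp add: field_simps)
      qed
      finally show ?thesis .
    qed
    then show "\<exists>M. \<forall>y\<ge>M. \<forall>z>y. dist (char_sum \<psi> y) (char_sum \<psi> z) < e" by blast
  qed
  then show ?thesis unfolding L_one_def
    by (simp add: Cauchy_convergent convergent_LIMSEQ_iff[symmetric])
qed

lemma norm_L_one_diff_le: "norm (L_one \<psi> - char_sum \<psi> y) \<le> 2 * real m / real (Suc y)"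
proof (rule LIMSEQ_le_const2)
  show "(\<lambda>z. norm (char_sum \<psi> z - char_sum \<psi> y)) \<longlonglongrightarrow> norm (L_one \<psi> - char_sum \<psi> y)"
    by (intro tendsto_intros char_sum_tendsto)
qed (use norm_char_sum_diff_le in blast)

lemma bounded_char_ln_sum: "\<exists>C. \<forall>x. norm (\<Sum>n=1..x. \<psi> n * of_real (ln (real n) / real n)) \<le> C"
proof (intro exI allI)
  fix x
  let ?f = "\<lambda>n. \<psi> n * of_real (ln (real n) / real n)"
  have "{1..x} = ({1..x} \<inter> {..<3}) \<union> {3..<Suc x}" by auto
  then have "sum ?f {1..x} = sum ?f ({1..x} \<inter> {..<3}) + sum ?f {3..<Suc x}"
    by (metis (no_types, lifting) sum.union_disjoint finite_Int finite_atLeastAtMost finite_atLeastLessThan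
        disjoint_iff Int_iff lessThan_iff atLeastLessThan_iff not_le)
  also have "norm \<dots> \<le> (\<Sum>n\<in>{1..x} \<inter> {..<3}. norm (?f n)) + 2 * real m * (ln (real 3) / real 3)"
    using ln_over_self_antimono
    by (intro order.trans[OF norm_triangle_ineq] add_mono norm_sum
        norm_sum_mult_antimono_le[OF norm_sum_atLeastLessThan_le]) auto
  also have "(\<Sum>n\<in>{1..x} \<inter> {..<3}. norm (?f n)) \<le> (\<Sum>n<3. norm (?f n))"
    by (intro sum_mono2) auto
  finally show "norm (sum ?f {1..x}) \<le> (\<Sum>n<3. norm (?f n)) + 2 * real m * (ln (real 3) / real 3)"
    by simp
qed

text \<open>The Dirichlet series identity \<open>- L' = L \<cdot> (- L' / L)\<close> at \<open>1\<close>, in truncated form. It holds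
  because \<open>ln n\<close> is the divisor sum of \<open>\<Lambda>\<close>.\<close>

lemma char_ln_sum_eq:
  "(\<Sum>n=1..x. \<psi> n * of_real (ln (real n) / real n))
   = (\<Sum>d=1..x. \<psi> d * of_real (mangoldt d / real d) * char_sum \<psi> (x div d))"
proof -
  let ?h = "\<lambda>d k. \<psi> d * of_real (mangoldt d / real d) * (\<psi> k / of_nat k)"
  have "(\<Sum>d | d dvd n. ?h d (n div d)) = \<psi> n * of_real (ln (real n) / real n)" if "n \<in> {1..x}" for n
  proof -
    have "?h d (n div d) = \<psi> n / of_nat n * of_real (mangoldt d)" if "d dvd n" for d
      using that by (auto elim!: dvdE simp: mult)
    then have "(\<Sum>d | d dvd n. ?h d (n div d)) = \<psi> n / of_nat n * of_real (\<Sum>d | d dvd n. mangoldt d)"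
      by (simp add: sum_distrib_left)
    then show ?thesis using mangoldt_sum[of n, where 'a = complex] that by simp
  qed
  then have "(\<Sum>n=1..x. \<psi> n * of_real (ln (real n) / real n)) = (\<Sum>n=1..x. \<Sum>d | d dvd n. ?h d (n div d))"
    by simp
  also have "\<dots> = (\<Sum>d=1..x. \<Sum>k=1..x div d. ?h d k)" by (rule sum_divisors_swap)
  finally show ?thesis by (simp add: char_sum_def sum_distrib_left)
qed

text \<open>In \<open>char_ln_sum_eq\<close> replace each inner sum by its limit \<open>L_one \<psi>\<close>. The error for
  \<open>d\<close> is \<open>O(\<Lambda>(d)/d \<cdot> d/x)\<close>, and these errors sum to \<open>O(1)\<close> by Chebyshev's bound.\<close>

lemma mangoldt_char_sum_bounded_if_L_one_nonzero:
  assumes "L_one \<psi> \<noteq> 0"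
  shows "\<exists>C. \<forall>x. norm (mangoldt_char_sum \<psi> x) \<le> C"
proof -
  obtain C where C: "\<And>x. norm (\<Sum>n=1..x. \<psi> n * of_real (ln (real n) / real n)) \<le> C"
    using bounded_char_ln_sum by blast
  have "norm (mangoldt_char_sum \<psi> x) \<le> (C + 8 * real m) / norm (L_one \<psi>)" for x
  proof -
    have alg: "l * w = w * t + w * (l - t)" for l w t :: complex by (simp add: algebra_simps)
    have "L_one \<psi> * mangoldt_char_sum \<psi> x = (\<Sum>n=1..x. \<psi> n * of_real (ln (real n) / real n)) +
       (\<Sum>d=1..x. \<psi> d * of_real (mangoldt d / real d) * (L_one \<psi> - char_sum \<psi> (x div d)))"
      unfolding char_ln_sum_eq mangoldt_char_sum_def
      unfolding sum_distrib_left sum.distrib [symmetric]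
      by (intro sum.cong refl alg)
    also have "norm \<dots> \<le> C + (\<Sum>d=1..x. 2 * real m / real x * mangoldt d)"
    proof (intro order.trans[OF norm_triangle_ineq] add_mono C sum_norm_le)
      fix d assume d: "d \<in> {1..x}"
      have "norm (\<psi> d * of_real (mangoldt d / real d) * (L_one \<psi> - char_sum \<psi> (x div d)))
          = norm (\<psi> d) * (mangoldt d / real d * norm (L_one \<psi> - char_sum \<psi> (x div d)))"
        using mangoldt_nonneg[of d] by (simp add: norm_mult norm_divide)
      also have "\<dots> \<le> 1 * (mangoldt d / real d * (2 * real m / real (Suc (x div d))))"
        using mangoldt_nonneg[of d] by (intro mult_mono norm_le_1 norm_L_one_diff_le order.refl) auto
      also have "\<dots> = (2 * real m * mangoldt d) / (real d * real (Suc (x div d)))" by simp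
      also have "\<dots> \<le> (2 * real m * mangoldt d) / real x"
        using d of_nat_le_mult_Suc_div[of d x] mangoldt_nonneg[of d]
        by (intro divide_left_mono) (auto intro!: mult_pos_pos)
      finally show "norm (\<psi> d * of_real (mangoldt d / real d) * (L_one \<psi> - char_sum \<psi> (x div d)))
          \<le> 2 * real m / real x * mangoldt d" by simp
    qed
    also have "(\<Sum>d=1..x. 2 * real m / real x * mangoldt d) \<le> 8 * real m"
    proof (cases "x = 0")
      case False
      have "(\<Sum>d=1..x. 2 * real m / real x * mangoldt d) = 2 * real m / real x * (\<Sum>d=1..x. mangoldt d)"
        by (rule sum_distrib_left [symmetric])
      also have "\<dots> \<le> 2 * real m / real x * (4 * real x)"
        by (intro mult_left_mono sum_mangoldt_le) auto
      finally show ?thesis using False by simp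
    qed auto
    finally show ?thesis using assms by (simp add: norm_mult pos_le_divide_eq mult.commute)
  qed
  then show ?thesis by blast
qed

text \<open>By Moebius inversion, \<open>\<Lambda>(n)\<close> plus \<open>ln x\<close> at \<open>n = 1\<close> is the divisor sum of
  \<open>\<mu>(d) (ln x - ln d)\<close>. Once \<open>L_one \<psi> = 0\<close>, the inner sums are \<open>O(d/x)\<close>, and the total is
  controlled by \<open>x ln x - ln (fact x) \<le> x\<close>.\<close>

lemma mangoldt_char_sum_if_L_one_zero:
  assumes "L_one \<psi> = 0" "x \<ge> 1"
  shows "norm (mangoldt_char_sum \<psi> x + of_real (ln (real x))) \<le> 2 * real m"
proof -
  let ?h = "\<lambda>d k. \<psi> d * of_real (moebius_mu d * (ln (real x) - ln (real d)) / real d) * (\<psi> k / of_nat k)"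
  have "(\<Sum>d | d dvd n. ?h d (n div d))
      = (if n = 1 then of_real (ln (real x)) else 0) + \<psi> n * of_real (mangoldt n / real n)"
    if "n \<in> {1..x}" for n
  proof -
    have "?h d (n div d) = \<psi> n / of_nat n * of_real (moebius_mu d * ln (real x) - moebius_mu d * ln (real d))"
      if "d dvd n" for d
      using that by (auto elim!: dvdE simp: mult algebra_simps diff_divide_distrib)
    then have "(\<Sum>d | d dvd n. ?h d (n div d)) = \<psi> n / of_nat n *
        of_real (\<Sum>d | d dvd n. moebius_mu d * ln (real x) - moebius_mu d * ln (real d))"
      by (simp add: sum_distrib_left)
    moreover have "(\<Sum>d | d dvd n. moebius_mu d * ln (real x) - moebius_mu d * ln (real d))
        = (\<Sum>d | d dvd n. moebius_mu d) * ln (real x) - (\<Sum>d | d dvd n. moebius_mu d * ln (real d))"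
      by (simp add: sum_subtractf sum_distrib_right)
    moreover have "n > 0" using that by simp
    ultimately show ?thesis using sum_moebius_mu[OF \<open>n > 0\<close>] sum_moebius_mu_ln[OF \<open>n > 0\<close>]
      by (simp del: of_real_sum)
  qed
  then have "(\<Sum>n=1..x. \<Sum>d | d dvd n. ?h d (n div d))
    = (\<Sum>n=1..x. (if n = 1 then of_real (ln (real x)) else 0) + \<psi> n * of_real (mangoldt n / real n))"
    by (intro sum.cong) auto
  also have "\<dots> = mangoldt_char_sum \<psi> x + of_real (ln (real x))"
    using assms(2) by (simp add: sum.distrib mangoldt_char_sum_def)
  finally have "mangoldt_char_sum \<psi> x + of_real (ln (real x)) = (\<Sum>d=1..x. \<Sum>k=1..x div d. ?h d k)"
    using sum_divisors_swap[of ?h x] by metis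
  also have "\<dots> = (\<Sum>d=1..x. \<psi> d * of_real (moebius_mu d * (ln (real x) - ln (real d)) / real d) * char_sum \<psi> (x div d))"
    by (simp add: char_sum_def sum_distrib_left)
  also have "norm \<dots> \<le> (\<Sum>d=1..x. 2 * real m / real x * (ln (real x) - ln (real d)))"
  proof (rule sum_norm_le)
    fix d assume d: "d \<in> {1..x}"
    then have ln: "ln (real x) - ln (real d) \<ge> 0" by simp
    have "norm (\<psi> d * of_real (moebius_mu d * (ln (real x) - ln (real d)) / real d) * char_sum \<psi> (x div d))
        = norm (\<psi> d) * (\<bar>moebius_mu d\<bar> * (ln (real x) - ln (real d)) / real d * norm (char_sum \<psi> (x div d)))"
      using ln by (simp add: norm_mult norm_divide abs_mult del: of_real_mult of_real_diff of_real_divide)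
    also have "\<dots> \<le> 1 * (1 * (ln (real x) - ln (real d)) / real d * (2 * real m / real (Suc (x div d))))"
      using ln norm_L_one_diff_le[of "x div d"] assms(1)
      by (intro mult_mono norm_le_1 divide_right_mono abs_moebius_mu_le order.refl) auto
    also have "\<dots> = (2 * real m * (ln (real x) - ln (real d))) / (real d * real (Suc (x div d)))" by simp
    also have "\<dots> \<le> (2 * real m * (ln (real x) - ln (real d))) / real x"
      using d of_nat_le_mult_Suc_div[of d x] ln
      by (intro divide_left_mono) (auto intro!: mult_pos_pos)
    finally show "norm (\<psi> d * of_real (moebius_mu d * (ln (real x) - ln (real d)) / real d) * char_sum \<psi> (x div d))
       \<le> 2 * real m / real x * (ln (real x) - ln (real d))" by simp
  qed
  also have "\<dots> = 2 * real m / real x * (real x * ln (real x) - ln (fact x))"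
    by (simp add: sum_distrib_left [symmetric] sum_divide_distrib [symmetric] sum_subtractf ln_fact_eq_sum)
  also have "\<dots> \<le> 2 * real m / real x * real x"
    using ln_fact_ge[OF assms(2)] by (intro mult_left_mono) auto
  finally show ?thesis using assms(2) by simp
qed

end

section \<open>Nonvanishing for real characters\<close>

text \<open>Divisors of \<open>p^(k+1) n\<close> either are prime to \<open>p\<close>, hence divide \<open>n\<close>, or are \<open>p\<close> times a divisor of
  \<open>p^k n\<close>.\<close>

lemma sum_divisors_prime_power_mult:
  fixes f :: "nat \<Rightarrow> real"
  assumes mult: "\<And>a b. f (a * b) = f a * f b" and p: "prime p" "\<not> p dvd n" "n > 0"
  shows "(\<Sum>d | d dvd p ^ k * n. f d) = (\<Sum>i\<le>k. f p ^ i) * (\<Sum>d | d dvd n. f d)"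
proof (induction k)
  case (Suc k)
  let ?N = "p ^ Suc k * n"
  have fin: "finite {d. d dvd ?N}" using p by (intro finite_divisors_nat) (auto simp: prime_gt_0_nat)
  have "(\<Sum>d | d dvd ?N. f d) = sum f {d. d dvd ?N \<and> \<not> p dvd d} + sum f {d. d dvd ?N \<and> p dvd d}"
    by (subst sum.union_disjoint [symmetric]) (auto intro!: sum.cong finite_subset[OF _ fin])
  also have "{d. d dvd ?N \<and> \<not> p dvd d} = {d. d dvd n}"
  proof (intro Collect_cong iffI conjI; (elim conjE)?)
    fix d assume "d dvd ?N" "\<not> p dvd d"
    then have "coprime d (p ^ Suc k)"
      using prime_imp_coprime[OF p(1)] by (simp add: coprime_commute)
    then show "d dvd n" using \<open>d dvd ?N\<close> by (simp only: coprime_dvd_mult_right_iff)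
  next
    fix d assume "d dvd n"
    then show "d dvd ?N" by simp
    show "\<not> p dvd d" using \<open>d dvd n\<close> p(2) dvd_trans by blast
  qed
  also have "sum f {d. d dvd ?N \<and> p dvd d} = (\<Sum>d | d dvd p ^ k * n. f (p * d))"
    using p by (intro sum.reindex_bij_witness[where i = "\<lambda>d. p * d" and j = "\<lambda>d. d div p"])
      (auto simp: prime_gt_0_nat mult.assoc)
  also have "\<dots> = f p * (\<Sum>d | d dvd p ^ k * n. f d)"
    by (simp add: mult sum_distrib_left)
  also have "\<dots> = (\<Sum>i\<le>k. f p ^ Suc i) * (\<Sum>d | d dvd n. f d)"
    by (simp add: Suc.IH sum_distrib_left [symmetric] mult.assoc)
  finally show ?case by (simp add: sum.atMost_Suc_shift distrib_right del: sum.atMost_Suc power_Suc)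
qed simp

lemma sum_powers_of_sign:
  fixes y :: real assumes "y = -1 \<or> y = 0 \<or> y = 1"
  shows "(\<Sum>i\<le>k. y ^ i) \<ge> 0" "even k \<Longrightarrow> (\<Sum>i\<le>k. y ^ i) \<ge> 1"
proof -
  have "(\<Sum>i\<le>k. (-1::real) ^ i) = (if even k then 1 else 0)" by (induction k) auto
  moreover have "(\<Sum>i\<le>k. (0::real) ^ i) = 1" by (induction k) auto
  ultimately show "(\<Sum>i\<le>k. y ^ i) \<ge> 0" "even k \<Longrightarrow> (\<Sum>i\<le>k. y ^ i) \<ge> 1" using assms by auto
qed

text \<open>The divisor sum is multiplicative and at a prime power it is a geometric sum with ratio
  \<open>-1\<close>, \<open>0\<close> or \<open>1\<close>; for even exponents this geometric sum is at least \<open>1\<close>.\<close>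

lemma sum_divisors_sign_char:
  fixes f :: "nat \<Rightarrow> real"
  assumes one: "f 1 = 1" and mult: "\<And>a b. f (a * b) = f a * f b"
    and sign: "\<And>a. f a = -1 \<or> f a = 0 \<or> f a = 1" and n: "n > 0"
  shows "(\<Sum>d | d dvd n. f d) \<ge> 0" "(\<Sum>d | d dvd n ^ 2. f d) \<ge> 1"
proof -
  have "(\<Sum>d | d dvd n. f d) \<ge> 0 \<and> (\<Sum>d | d dvd n ^ 2. f d) \<ge> 1"
    using n
  proof (induction n rule: less_induct)
    case (less n)
    show ?case
    proof (cases "n = 1")
      case False
      then obtain p where p: "prime p" "p dvd n" by (metis prime_factor_nat)
      define k where "k = multiplicity p n"
      obtain t where t: "n = p ^ k * t" "\<not> p dvd t"
        using multiplicity_decompose'[of n p] less.prems p(1) unfolding k_def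
        by (metis not_prime_unit not_gr_zero)
      have "k > 0" using p less.prems by (simp add: k_def prime_multiplicity_gt_zero_iff)
      then have "p ^ k > 1" using p(1) prime_gt_1_nat one_less_power by blast
      then have "t < n" "t > 0" using t(1) less.prems by (auto intro!: Nat.gr0I)
      note IH = less.IH[OF this]
      have "(\<Sum>d | d dvd n. f d) = (\<Sum>i\<le>k. f p ^ i) * (\<Sum>d | d dvd t. f d)"
        unfolding t(1) using sum_divisors_prime_power_mult[OF mult p(1) t(2) \<open>t > 0\<close>] .
      moreover have "n ^ 2 = p ^ (2 * k) * t ^ 2" using t(1) by (simp add: power_mult_distrib power_mult mult.commute)
      then have "(\<Sum>d | d dvd n ^ 2. f d) = (\<Sum>i\<le>2*k. f p ^ i) * (\<Sum>d | d dvd t ^ 2. f d)"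
        using sum_divisors_prime_power_mult[OF mult p(1), of "t ^ 2" "2 * k"] \<open>t > 0\<close> t(2) p(1)
        by (simp add: prime_dvd_power_iff)
      moreover have "1 * 1 \<le> (\<Sum>i\<le>2*k. f p ^ i) * (\<Sum>d | d dvd t ^ 2. f d)"
        using sum_powers_of_sign[OF sign[of p]] IH by (intro mult_mono) auto
      ultimately show ?thesis using sum_powers_of_sign[OF sign[of p]] IH by simp
    qed (use one in auto)
  qed
  then show "(\<Sum>d | d dvd n. f d) \<ge> 0" "(\<Sum>d | d dvd n ^ 2. f d) \<ge> 1" by auto
qed

text \<open>The inequality of arithmetic and geometric means, applied to the terms with indices \<open>i\<close>
  and \<open>n - 1 - i\<close>.\<close>

lemma sum_even_powers_ge:
  fixes y :: real shows "real n * y ^ (n - 1) \<le> (\<Sum>i<n. y ^ (2 * i))"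
proof -
  have pair: "2 * y ^ (n - 1) \<le> y ^ (2 * i) + y ^ (2 * (n - Suc i))" if "i < n" for i
  proof -
    have "0 \<le> (y ^ i - y ^ (n - Suc i))\<^sup>2" by simp
    also have "\<dots> = y ^ (2 * i) + y ^ (2 * (n - Suc i)) - 2 * y ^ (i + (n - Suc i))"
      by (simp add: power2_diff power_mult [symmetric] power_add mult.commute)
    finally show ?thesis using that by simp
  qed
  have "2 * (real n * y ^ (n - 1)) = (\<Sum>i<n. 2 * y ^ (n - 1))" by simp
  also have "\<dots> \<le> (\<Sum>i<n. y ^ (2 * i) + y ^ (2 * (n - Suc i)))" by (intro sum_mono pair) auto
  also have "\<dots> = 2 * (\<Sum>i<n. y ^ (2 * i))"
    using sum.nat_diff_reindex[of "\<lambda>i. y ^ (2 * i)" n] by (simp add: sum.distrib)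
  finally show ?thesis by simp
qed

text \<open>With \<open>s k = 1 + x + \<dots> + x^(k-1)\<close> the weight is
  \<open>b k = (1/k - x^k / s k) / (1 - x)\<close>, and \<open>b n - b (n+1)\<close> is a positive multiple of
  \<open>1 / (n (n+1)) - x^n / (s n s (n+1))\<close>. Writing \<open>x = y\<^sup>2\<close>, \<open>sum_even_powers_ge\<close> gives
  \<open>s n s (n+1) \<ge> n (n+1) y^(2n-1)\<close>, and \<open>y^(2n-1) \<ge> x^n\<close>.\<close>

lemma monsky_weight_antimono:
  fixes x :: real
  assumes x: "0 < x" "x < 1" and n: "n > 0"
  defines "b \<equiv> \<lambda>n. 1 / (real n * (1 - x)) - x ^ n / (1 - x ^ n)"
  shows "b (Suc n) \<le> b n" "b n \<ge> 0"
proof -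
  define y where "y = sqrt x"
  have y: "0 < y" "y < 1" "x = y ^ 2" using x by (auto simp: y_def)
  define s where "s = (\<lambda>n. \<Sum>i<n. x ^ i)"
  have s_ge: "real k * y ^ (k - 1) \<le> s k" for k
    using sum_even_powers_ge[of k y] by (simp add: s_def y(3) power_mult)
  have geom: "1 - x ^ k = (1 - x) * s k" for k unfolding s_def by (rule one_diff_power_eq)
  have pos: "s k > 0" if "k > 0" for k
    using that x unfolding s_def by (intro sum_pos) auto
  have b: "b k = (1 / real k - x ^ k / s k) / (1 - x)" if "k > 0" for k
    by (simp add: b_def geom diff_divide_distrib mult.commute)
  have "x ^ n * real n \<le> real n * y ^ (n - 1)"
  proof -
    have "x ^ n \<le> y ^ (n - 1)" unfolding y(3) power_mult [symmetric]
      using y by (intro power_decreasing) auto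
    then show ?thesis by (simp add: mult.commute mult_left_mono)
  qed
  then have "x ^ n * real n \<le> s n" using s_ge[of n] by simp
  then show "b n \<ge> 0" using x n pos[OF n] by (simp add: b field_simps)
  have step: "s (Suc n) - x * s n = 1"
  proof -
    have "s (Suc n) = 1 + (\<Sum>i<n. x ^ Suc i)" unfolding s_def by (simp add: sum.lessThan_Suc_shift del: sum.lessThan_Suc)
    then show ?thesis by (simp add: s_def sum_distrib_left)
  qed
  have expo: "2 * n - 1 = (n - 1) + (Suc n - 1)" using n by simp
  have "x ^ n * (real n * real (Suc n)) \<le> y ^ (2 * n - 1) * (real n * real (Suc n))"
    unfolding y(3) power_mult [symmetric] using y by (intro mult_right_mono power_decreasing) auto
  also have "\<dots> = (real n * y ^ (n - 1)) * (real (Suc n) * y ^ (Suc n - 1))"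
    unfolding expo by (simp only: power_add mult_ac)
  also have "\<dots> \<le> s n * s (Suc n)"
    using y by (intro mult_mono s_ge) (auto intro: less_imp_le pos n)
  finally have le: "x ^ n / (s n * s (Suc n)) \<le> 1 / (real n * real (Suc n))"
    using n pos[of n] pos[of "Suc n"] by (simp add: divide_simps del: of_nat_Suc)
  have "x ^ n / s n - x ^ Suc n / s (Suc n) = x ^ n * (s (Suc n) - x * s n) / (s n * s (Suc n))"
    using pos[of n] pos[of "Suc n"] n by (simp add: field_simps)
  also have "\<dots> \<le> 1 / (real n * real (Suc n))" using le step by simp
  also have "\<dots> = 1 / real n - 1 / real (Suc n)" using n by (simp add: field_simps)
  finally have "1 / real (Suc n) - x ^ Suc n / s (Suc n) \<le> 1 / real n - x ^ n / s n" by simp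
  then show "b (Suc n) \<le> b n"
    using x n b[of n] b[of "Suc n"] by (simp add: divide_right_mono del: of_nat_Suc power_Suc)
qed

context nonprincipal_char
begin

text \<open>Expand the sum into the Lambert series \<open>\<Sum>d. \<psi>(d) x^d / (1 - x^d)\<close>, and write
  \<open>x^d / (1 - x^d) = 1 / (d (1 - x)) - b d\<close>. The first part sums to
  \<open>L_one \<psi> / (1 - x) = 0\<close>; the second is bounded by Abel summation, uniformly in \<open>x\<close>, because the weights
  \<open>b\<close> decrease from \<open>b 1 = 1\<close>. To work with finite sums the series is cut at \<open>K\<close>,
  and \<open>K\<close> tends to infinity.\<close>

lemma real_char_lambert_bound:
  assumes L: "L_one \<psi> = 0" and x: "0 < x" "x < 1"
    and nonneg: "\<And>n. (\<Sum>d | d dvd n. Re (\<psi> d)) \<ge> 0"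
  shows "(\<Sum>n=1..N. (\<Sum>d | d dvd n. Re (\<psi> d)) * x ^ n) \<le> 2 * real m"
proof -
  define c where "c = (\<lambda>n. \<Sum>d | d dvd n. Re (\<psi> d))"
  define b where "b = (\<lambda>n. 1 / (real n * (1 - x)) - x ^ n / (1 - x ^ n))"
  have b1: "b 1 = 1" using x by (simp add: b_def field_simps)
  have xp: "x ^ d < 1" if "d > 0" for d using x that by (simp add: power_less_one_iff)
  have bound: "(\<Sum>n=1..K. c n * x ^ n) \<le> 2 * real m + 2 * real m / (1 - x) / real (Suc K) + real K * x ^ K / (1 - x)" for K
  proof -
    have "(\<Sum>n=1..K. c n * x ^ n) = (\<Sum>n=1..K. \<Sum>d | d dvd n. Re (\<psi> d) * (x ^ d) ^ (n div d))"
      by (intro sum.cong refl) (auto simp: c_def sum_distrib_right power_mult [symmetric] intro!: sum.cong)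
    also have "\<dots> = (\<Sum>d=1..K. \<Sum>k=1..K div d. Re (\<psi> d) * (x ^ d) ^ k)"
      by (rule sum_divisors_swap[where h = "\<lambda>d k. Re (\<psi> d) * (x ^ d) ^ k"])
    also have "\<dots> = (\<Sum>d=1..K. Re (\<psi> d) * (1 / (real d * (1 - x))) - Re (\<psi> d) * b d - Re (\<psi> d) * ((x ^ d) ^ Suc (K div d) / (1 - x ^ d)))"
    proof (intro sum.cong refl)
      fix d assume "d \<in> {1..K}"
      then have d: "x ^ d < 1" using xp by auto
      have "(\<Sum>k=1..K div d. (x ^ d) ^ k) = (x ^ d - (x ^ d) ^ Suc (K div d)) / (1 - x ^ d)"
        using sum_gp[of "x ^ d" 1 "K div d"] d by (simp add: not_less)
      then have "(\<Sum>k=1..K div d. (x ^ d) ^ k)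
         = 1 / (real d * (1 - x)) - b d - (x ^ d) ^ Suc (K div d) / (1 - x ^ d)"
        by (simp add: b_def diff_divide_distrib)
      then show "(\<Sum>k=1..K div d. Re (\<psi> d) * (x ^ d) ^ k)
         = Re (\<psi> d) * (1 / (real d * (1 - x))) - Re (\<psi> d) * b d - Re (\<psi> d) * ((x ^ d) ^ Suc (K div d) / (1 - x ^ d))"
        by (simp only: sum_distrib_left [symmetric] right_diff_distrib)
    qed
    also have "\<dots> = (\<Sum>d=1..K. Re (\<psi> d) * (1 / (real d * (1 - x)))) - (\<Sum>d=1..K. Re (\<psi> d) * b d)
       - (\<Sum>d=1..K. Re (\<psi> d) * ((x ^ d) ^ Suc (K div d) / (1 - x ^ d)))"
      by (simp add: sum_subtractf)
    finally have eq: "(\<Sum>n=1..K. c n * x ^ n) = \<dots>" .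
    \<comment> \<open>the tail of the series for \<open>L_one \<psi> = 0\<close>\<close>
    have 1: "(\<Sum>d=1..K. Re (\<psi> d) * (1 / (real d * (1 - x)))) \<le> 2 * real m / (1 - x) / real (Suc K)"
    proof -
      have "(\<Sum>d=1..K. Re (\<psi> d) * (1 / (real d * (1 - x)))) = Re (char_sum \<psi> K) / (1 - x)"
        by (simp add: char_sum_def sum_divide_distrib Re_divide_of_nat)
      also have "\<dots> \<le> (2 * real m / real (Suc K)) / (1 - x)"
        using norm_L_one_diff_le[of K] L x complex_Re_le_cmod[of "char_sum \<psi> K"]
        by (intro divide_right_mono) auto
      finally show ?thesis by (simp add: mult.commute)
    qed
    have 2: "- (\<Sum>d=1..K. Re (\<psi> d) * b d) \<le> 2 * real m"
    proof -
      have "norm (\<Sum>d=1..<Suc K. \<psi> d * of_real (b d)) \<le> 2 * real m * b 1"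
        using monsky_weight_antimono[OF x] unfolding b_def
        by (intro norm_sum_mult_antimono_le norm_sum_atLeastLessThan_le) auto
      moreover have "Re (\<Sum>d=1..<Suc K. \<psi> d * of_real (b d)) = (\<Sum>d=1..K. Re (\<psi> d) * b d)"
        by (simp add: atLeastLessThanSuc_atLeastAtMost)
      ultimately show ?thesis using b1 abs_Re_le_cmod[of "\<Sum>d=1..<Suc K. \<psi> d * of_real (b d)"] by simp
    qed
    \<comment> \<open>what the inner geometric series miss beyond \<open>K div d\<close>; the exponent exceeds \<open>K\<close>\<close>
    have 3: "- (\<Sum>d=1..K. Re (\<psi> d) * ((x ^ d) ^ Suc (K div d) / (1 - x ^ d))) \<le> real K * x ^ K / (1 - x)"
    proof -
      have "\<bar>\<Sum>d=1..K. Re (\<psi> d) * ((x ^ d) ^ Suc (K div d) / (1 - x ^ d))\<bar> \<le> (\<Sum>d=1..K. 1 * (x ^ K / (1 - x)))"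
      proof (intro order.trans[OF sum_abs] sum_mono)
        fix d assume d: "d \<in> {1..K}"
        then have "K \<le> d * Suc (K div d)" using of_nat_le_mult_Suc_div[of d K] by (metis of_nat_le_iff of_nat_mult atLeastAtMost_iff One_nat_def Suc_le_eq)
        then have "(x ^ d) ^ Suc (K div d) \<le> x ^ K"
          unfolding power_mult [symmetric] using x by (intro power_decreasing) auto
        moreover have "x ^ d \<le> x ^ 1" using d x by (intro power_decreasing) auto
        ultimately have "(x ^ d) ^ Suc (K div d) / (1 - x ^ d) \<le> x ^ K / (1 - x)"
          using x by (intro frac_le) auto
        moreover have "\<bar>Re (\<psi> d)\<bar> \<le> 1" using abs_Re_le_cmod[of "\<psi> d"] norm_le_1[of d] by linarith
        moreover have nn: "0 \<le> (x ^ d) ^ Suc (K div d) / (1 - x ^ d)" using x xp[of d] d by auto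
        ultimately show "\<bar>Re (\<psi> d) * ((x ^ d) ^ Suc (K div d) / (1 - x ^ d))\<bar> \<le> 1 * (x ^ K / (1 - x))"
          unfolding abs_mult abs_of_nonneg[OF nn] by (intro mult_mono) auto
      qed
      then show ?thesis by simp
    qed
    show ?thesis unfolding eq using 1 2 3 by linarith
  qed
  have "(\<lambda>K. 2 * real m + 2 * real m / (1 - x) / real (Suc K) + real K * x ^ K / (1 - x)) \<longlonglongrightarrow> 2 * real m + 0 + 0 / (1 - x)"
    using x powser_times_n_limit_0[of x]
    by (intro tendsto_intros LIMSEQ_Suc[OF lim_const_over_n]) auto
  moreover have "\<forall>K\<ge>N. (\<Sum>n=1..N. c n * x ^ n) \<le> 2 * real m + 2 * real m / (1 - x) / real (Suc K) + real K * x ^ K / (1 - x)"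
  proof (intro allI impI)
    fix K assume "N \<le> K"
    then have "(\<Sum>n=1..N. c n * x ^ n) \<le> (\<Sum>n=1..K. c n * x ^ n)"
      using x nonneg by (intro sum_mono2) (auto simp: c_def)
    then show "(\<Sum>n=1..N. c n * x ^ n) \<le> 2 * real m + 2 * real m / (1 - x) / real (Suc K) + real K * x ^ K / (1 - x)"
      using bound[of K] by simp
  qed
  ultimately have "(\<Sum>n=1..N. c n * x ^ n) \<le> 2 * real m + 0 + 0 / (1 - x)"
    using LIMSEQ_le_const by blast
  then show ?thesis by (simp add: c_def)
qed

text \<open>If \<open>L_one \<psi>\<close> were \<open>0\<close>, letting \<open>x\<close> tend to \<open>1\<close> in \<open>real_char_lambert_bound\<close> would bound
  all partial sums of the nonnegative divisor sums \<open>c n\<close> by \<open>2 m\<close>, although \<open>c n \<ge> 1\<close> at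
  every square \<open>n\<close>.\<close>

lemma L_one_real_char_nonzero:
  assumes real: "\<And>a. cnj (\<psi> a) = \<psi> a"
  shows "L_one \<psi> \<noteq> 0"
proof
  assume L: "L_one \<psi> = 0"
  define c where "c = (\<lambda>n. \<Sum>d | d dvd n. Re (\<psi> d))"
  have Im: "Im (\<psi> a) = 0" for a using real[of a] by (simp add: complex_eq_iff)
  have sign: "Re (\<psi> a) = -1 \<or> Re (\<psi> a) = 0 \<or> Re (\<psi> a) = 1" for a
    using norm_eq_1[of a] eq_0_iff[of a] Im[of a]
    by (cases "coprime a m") (auto simp: cmod_def power2_eq_1_iff)
  have mult': "Re (\<psi> (a * b)) = Re (\<psi> a) * Re (\<psi> b)" for a b using Im by (simp add: mult)
  note c = sum_divisors_sign_char[of "\<lambda>n. Re (\<psi> n)", OF _ mult' sign]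
  have nonneg: "c n \<ge> 0" for n using c(1)[of n] by (cases "n = 0") (auto simp: c_def)
  have c2: "c (n ^ 2) \<ge> 1" if "n > 0" for n using c(2)[OF _ that] by (simp add: c_def)
  \<comment> \<open>among \<open>1, \<dots>, s\<^sup>2\<close> there are \<open>s\<close> squares, one more than the bound allows\<close>
  define s where "s = 2 * m + 1"
  have "((\<lambda>x. \<Sum>n=1..s^2. c n * x ^ n) \<longlongrightarrow> (\<Sum>n=1..s^2. c n * 1 ^ n)) (at_left 1)"
    by (intro tendsto_intros)
  moreover have "eventually (\<lambda>x. (\<Sum>n=1..s^2. c n * x ^ n) \<le> 2 * real m) (at_left 1)"
    unfolding eventually_at_left_field
    by (rule exI[of _ 0]) (use real_char_lambert_bound[OF L] nonneg in \<open>auto simp: c_def\<close>)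
  ultimately have "(\<Sum>n=1..s^2. c n) \<le> 2 * real m"
    using tendsto_upperbound[of "\<lambda>x. \<Sum>n=1..s^2. c n * x ^ n"] by simp
  moreover have "real s \<le> (\<Sum>n=1..s^2. c n)"
  proof -
    have "real s = (\<Sum>n=1..s. 1)" by simp
    also have "\<dots> \<le> (\<Sum>n=1..s. c (n ^ 2))" by (intro sum_mono c2) auto
    also have "\<dots> = (\<Sum>n\<in>(\<lambda>n. n ^ 2) ` {1..s}. c n)"
      by (subst sum.reindex) (auto simp: inj_on_def)
    also have "\<dots> \<le> (\<Sum>n=1..s^2. c n)"
      by (intro sum_mono2 nonneg) (auto simp: power2_eq_square intro: mult_le_mono)
    finally show ?thesis .
  qed
  ultimately show False by (simp add: s_def)
qed

end

section \<open>Dirichlet's theorem on primes in arithmetic progressions\<close>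

lemma sum_Un_le_nonneg:
  fixes f :: "'a \<Rightarrow> real"
  assumes "finite A" "finite B" "\<And>x. f x \<ge> 0"
  shows "sum f (A \<union> B) \<le> sum f A + sum f B"
  using assms by (subst sum_Un) (auto intro!: sum_nonneg)

lemma ln_unbounded: "\<not> (\<forall>x\<ge>1. ln (real x) \<le> K)"
proof
  assume *: "\<forall>x\<ge>1. ln (real x) \<le> K"
  obtain x where x: "exp K < real x" using reals_Archimedean2 by blast
  then have "real x > 0" using exp_gt_zero[of K] by linarith
  then have "K < ln (real x)" using x ln_less_cancel_iff[of "exp K" "real x"] by simp
  moreover have "x \<ge> 1" using \<open>real x > 0\<close> by simp
  then have "ln (real x) \<le> K" using * by blast
  ultimately show False by linarith
qed

text \<open>Here \<open>b\<close> is the inverse of \<open>a\<close> modulo \<open>m\<close>, so that \<open>\<psi> b\<close> is the conjugate of \<open>\<psi> a\<close>.\<close>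

lemma dirichlet_chars_orthogonality:
  assumes "m > 0" "[a * b = 1] (mod m)"
  shows "(\<Sum>\<psi>\<in>dirichlet_chars m. \<psi> b * mangoldt_char_sum \<psi> x)
     = of_nat (card (dirichlet_chars m)) * of_real (\<Sum>n | n \<in> {1..x} \<and> [n = a] (mod m). mangoldt n / real n)"
proof -
  have iff: "[b * n = 1] (mod m) \<longleftrightarrow> [n = a] (mod m)" for n
  proof
    assume "[b * n = 1] (mod m)"
    then have "[a * (b * n) = a * 1] (mod m)" by (rule cong_scalar_left)
    moreover have "[a * b * n = 1 * n] (mod m)" using assms(2) by (rule cong_scalar_right)
    ultimately show "[n = a] (mod m)" by (metis cong_sym cong_trans mult.assoc mult_1 mult_1_right)
  next
    assume "[n = a] (mod m)"
    then have "[b * n = b * a] (mod m)" by (rule cong_scalar_left)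
    then show "[b * n = 1] (mod m)" using assms(2) by (metis cong_trans mult.commute)
  qed
  have "(\<Sum>\<psi>\<in>dirichlet_chars m. \<psi> b * mangoldt_char_sum \<psi> x)
     = (\<Sum>\<psi>\<in>dirichlet_chars m. \<Sum>n=1..x. \<psi> (b * n) * of_real (mangoldt n / real n))"
    by (intro sum.cong refl)
      (auto simp: mangoldt_char_sum_def sum_distrib_left dirichlet_chars_def dirichlet_char.mult mult.assoc)
  also have "\<dots> = (\<Sum>n=1..x. (\<Sum>\<psi>\<in>dirichlet_chars m. \<psi> (b * n)) * of_real (mangoldt n / real n))"
    by (subst sum.swap) (simp add: sum_distrib_right sum_divide_distrib)
  also have "\<dots> = (\<Sum>n=1..x. if [n = a] (mod m) then of_nat (card (dirichlet_chars m)) * of_real (mangoldt n / real n) else 0)"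
    by (intro sum.cong refl) (simp add: sum_dirichlet_chars[OF assms(1)] iff[simplified])
  also have "\<dots> = (\<Sum>n | n \<in> {1..x} \<and> [n = a] (mod m). of_nat (card (dirichlet_chars m)) * of_real (mangoldt n / real n))"
    by (rule sum.inter_filter [symmetric]) simp
  finally show ?thesis by (simp add: sum_distrib_left)
qed

text \<open>Powers \<open>p^k\<close> with \<open>k \<ge> 2\<close> contribute at most \<open>2 ln p / p\<^sup>2\<close> for each \<open>p\<close>, and
  \<open>ln p \<le> 2 sqrt p\<close>; the sum over all integers \<open>p\<close> still converges.\<close>

lemma sum_mangoldt_nonprime_bounded:
  "\<exists>B. \<forall>x. (\<Sum>n | n \<in> {1..x} \<and> \<not> prime n. mangoldt n / real n) \<le> B"
proof -
  define g where "g = (\<lambda>p. 4 * (real p powr (-3/2)))"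
  have summ: "summable g" unfolding g_def by (intro summable_mult) (simp add: summable_real_powr_iff)
  have inner: "(\<Sum>k=2..x. ln (real p) / real p ^ k) \<le> g p" if p: "p \<ge> 2" for p x :: nat
  proof -
    have "(\<Sum>k=2..x. (1 / real p) ^ k) \<le> 2 * (1 / real p) ^ 2"
    proof (cases "x < 2")
      case False
      then have "(\<Sum>k=2..x. (1 / real p) ^ k) = ((1 / real p) ^ 2 - (1 / real p) ^ Suc x) / (1 - 1 / real p)"
        using p sum_gp[of "1 / real p" 2 x] by simp
      also have "\<dots> \<le> (1 / real p) ^ 2 / (1 / 2)"
        using p by (intro frac_le) (auto simp: field_simps)
      finally show ?thesis by simp
    qed auto
    moreover have "ln (real p) \<le> 2 * sqrt (real p)"
      using ln_le_minus_one[of "sqrt (real p)"] p ln_sqrt[of "real p"] by simp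
    ultimately have "ln (real p) * (\<Sum>k=2..x. (1 / real p) ^ k) \<le> 2 * sqrt (real p) * (2 * (1 / real p) ^ 2)"
      using p by (intro mult_mono sum_nonneg) auto
    also have "\<dots> = g p"
    proof -
      have "sqrt (real p) * (1 / real p) ^ 2 = real p powr (1/2) * real p powr (-2)"
        using p by (simp add: powr_half_sqrt powr_minus powr_numeral divide_simps)
      also have "\<dots> = real p powr (-3/2)" by (simp flip: powr_add)
      finally show ?thesis by (simp add: g_def)
    qed
    finally show ?thesis by (simp add: sum_distrib_left power_divide)
  qed
  have "(\<Sum>n | n \<in> {1..x} \<and> \<not> prime n. mangoldt n / real n) \<le> suminf g" for x
  proof -
    let ?I = "{p \<in> {2..x}. prime p} \<times> {2..x}"
    have "(\<Sum>n | n \<in> {1..x} \<and> \<not> prime n. mangoldt n / real n)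
        \<le> (\<Sum>n\<in>(\<lambda>(p,k). p ^ k) ` ?I. mangoldt n / real n)"
    proof -
      have "n \<in> (\<lambda>(p,k). p ^ k) ` ?I" if n: "n \<in> {1..x}" "\<not> prime n" "primepow n" for n
      proof -
        from n(3) obtain p k where pk: "prime p" "k > 0" "n = p ^ k" by (auto simp: primepow_def)
        have "k \<noteq> 1" using pk n(2) by auto
        moreover have "p ^ 1 \<le> p ^ k" using pk prime_ge_1_nat[of p] by (intro power_increasing) auto
        moreover have "k < p ^ k" using pk prime_ge_2_nat[of p] by (intro power_gt_expt) auto
        ultimately have "(p, k) \<in> ?I" using pk n(1) prime_ge_2_nat[of p] by auto
        then show ?thesis using pk(3) by force
      qed
      moreover have "(\<Sum>n | n \<in> {1..x} \<and> \<not> prime n. mangoldt n / real n)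
         = (\<Sum>n | n \<in> {1..x} \<and> \<not> prime n \<and> primepow n. mangoldt n / real n)"
        by (intro sum.mono_neutral_right) (auto simp: mangoldt_def)
      ultimately show ?thesis by (auto intro!: sum_mono2 simp: mangoldt_nonneg)
    qed
    also have "\<dots> = (\<Sum>(p,k)\<in>?I. ln (real p) / real p ^ k)"
    proof (subst sum.reindex)
      show "inj_on (\<lambda>(p,k). p ^ k) ?I"
        by (rule inj_onI) (auto simp: prime_power_inj'')
    qed (auto intro!: sum.cong)
    also have "\<dots> = (\<Sum>p | p \<in> {2..x} \<and> prime p. \<Sum>k=2..x. ln (real p) / real p ^ k)"
      by (rule sum.cartesian_product [symmetric])
    also have "\<dots> \<le> (\<Sum>p | p \<in> {2..x} \<and> prime p. g p)"
      by (intro sum_mono inner) auto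
    also have "\<dots> \<le> suminf g"
      by (intro sum_le_suminf summ) (auto simp: g_def)
    finally show ?thesis .
  qed
  then show ?thesis by blast
qed

lemma principal_mangoldt_sum_le:
  "x \<ge> 1 \<Longrightarrow> Re (mangoldt_char_sum (principal_char m) x) \<le> ln (real x) + 4"
proof -
  assume x: "x \<ge> 1"
  have "Re (mangoldt_char_sum (principal_char m) x) \<le> (\<Sum>n=1..x. mangoldt n / real n)"
    unfolding mangoldt_char_sum_def Re_sum
    by (intro sum_mono) (auto simp: principal_char_def mangoldt_nonneg)
  also have "\<dots> \<le> ln (real x) + 4" using mertens_upper[OF x] .
  finally show ?thesis .
qed

text \<open>The terms of Mertens' sum lost to the condition \<open>coprime n m\<close> are proper prime powers and
  the finitely many primes dividing \<open>m\<close>.\<close>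

lemma principal_mangoldt_sum_ge:
  assumes "m > 0"
  shows "\<exists>C. \<forall>x\<ge>1. ln (real x) - C \<le> Re (mangoldt_char_sum (principal_char m) x)"
proof -
  obtain B where B: "\<And>x. (\<Sum>n | n \<in> {1..x} \<and> \<not> prime n. mangoldt n / real n) \<le> B"
    using sum_mangoldt_nonprime_bounded by blast
  let ?f = "\<lambda>n. mangoldt n / real n"
  have f0: "?f n \<ge> 0" for n by (simp add: mangoldt_nonneg)
  have "ln (real x) - (1 + B + (\<Sum>n=1..m. ?f n)) \<le> Re (mangoldt_char_sum (principal_char m) x)" if "x \<ge> 1" for x
  proof -
    have prime_dvd: "n \<in> {1..m}" if "prime n" "\<not> coprime n m" for n
      using that assms prime_imp_coprime[of n m] dvd_imp_le[of n m] prime_ge_1_nat[of n] by auto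
    have "(\<Sum>n=1..x. ?f n) = (\<Sum>n | n \<in> {1..x} \<and> coprime n m. ?f n) + (\<Sum>n | n \<in> {1..x} \<and> \<not> coprime n m. ?f n)"
      by (subst sum.union_disjoint [symmetric]) (auto intro!: sum.cong)
    also have "(\<Sum>n | n \<in> {1..x} \<and> coprime n m. ?f n) = Re (mangoldt_char_sum (principal_char m) x)"
      unfolding mangoldt_char_sum_def Re_sum
      by (intro sum.mono_neutral_cong_left) (auto simp: principal_char_def)
    also have "(\<Sum>n | n \<in> {1..x} \<and> \<not> coprime n m. ?f n) \<le> (\<Sum>n\<in>{n. n \<in> {1..x} \<and> \<not> prime n} \<union> {1..m}. ?f n)"
      using f0 prime_dvd by (intro sum_mono2) auto
    also have "\<dots> \<le> (\<Sum>n | n \<in> {1..x} \<and> \<not> prime n. ?f n) + (\<Sum>n=1..m. ?f n)"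
      using f0 by (intro sum_Un_le_nonneg) auto
    finally show ?thesis using mertens_lower[OF that] B[of x] by simp
  qed
  then show ?thesis by blast
qed

text \<open>For real \<open>\<psi>\<close> this is \<open>L_one_real_char_nonzero\<close>. For nonreal \<open>\<psi>\<close> the conjugate would be
  a second zero; then among the sums \<open>mangoldt_char_sum\<close>, whose total is nonnegative, the principal character
  contributes \<open>ln x\<close>, the two zeros contribute \<open>- 2 ln x\<close>, and no other character has a positive coefficient of
  \<open>ln x\<close>.\<close>

lemma L_one_nonzero:
  assumes "nonprincipal_char m \<psi>"
  shows "L_one \<psi> \<noteq> 0"
proof
  assume L: "L_one \<psi> = 0"
  interpret nonprincipal_char m \<psi> by fact
  define \<psi>' where "\<psi>' = (\<lambda>a. cnj (\<psi> a))"
  have neq: "\<psi>' \<noteq> \<psi>"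
  proof
    assume eq: "\<psi>' = \<psi>"
    have "cnj (\<psi> a) = \<psi> a" for a using fun_cong[OF eq, of a] unfolding \<psi>'_def .
    then show False using L_one_real_char_nonzero L by blast
  qed
  have nonpr': "\<psi>' \<noteq> principal_char m"
  proof
    assume *: "\<psi>' = principal_char m"
    have "\<psi> a = principal_char m a" for a
      using fun_cong[OF *, of a] unfolding \<psi>'_def principal_char_def
      by (metis complex_cnj_cnj complex_cnj_one complex_cnj_zero)
    then show False using nonprincipal by blast
  qed
  interpret c: nonprincipal_char m \<psi>'
    using dirichlet_char_cnj[OF dirichlet_char_axioms] nonpr'
    by (simp add: nonprincipal_char_def nonprincipal_char_axioms_def \<psi>'_def)
  have L': "L_one \<psi>' = 0"
  proof -
    have "char_sum \<psi>' = (\<lambda>x. cnj (char_sum \<psi> x))" by (auto simp: char_sum_def \<psi>'_def)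
    then have "char_sum \<psi>' \<longlonglongrightarrow> cnj 0" using char_sum_tendsto L by (simp only: tendsto_cnj lim_cnj)
    then show ?thesis using c.char_sum_tendsto LIMSEQ_unique by fastforce
  qed
  \<comment> \<open>an upper bound for the coefficient of \<open>ln x\<close> contributed by each character\<close>
  define e where "e = (\<lambda>\<omega>. (if \<omega> = principal_char m then 1 else 0) - (if \<omega> = \<psi> then 1 else 0) - (if \<omega> = \<psi>' then 1 else (0::real)))"
  have "\<exists>C. \<forall>x\<ge>1. Re (mangoldt_char_sum \<omega> x) \<le> C + e \<omega> * ln (real x)" if "dirichlet_char m \<omega>" for \<omega>
  proof -
    have zero: "\<exists>C. \<forall>x\<ge>1. Re (mangoldt_char_sum \<omega> x) \<le> C + - 1 * ln (real x)"
      if "nonprincipal_char m \<omega>" "L_one \<omega> = 0"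
    proof (intro exI allI impI)
      fix x :: nat assume "1 \<le> x"
      then have "norm (mangoldt_char_sum \<omega> x + of_real (ln (real x))) \<le> 2 * real m"
        using nonprincipal_char.mangoldt_char_sum_if_L_one_zero that by blast
      then show "Re (mangoldt_char_sum \<omega> x) \<le> 2 * real m + - 1 * ln (real x)"
        using complex_Re_le_cmod[of "mangoldt_char_sum \<omega> x + of_real (ln (real x))"] by simp
    qed
    consider "\<omega> = principal_char m" | "\<omega> = \<psi> \<or> \<omega> = \<psi>'"
      | "\<omega> \<noteq> principal_char m" "\<omega> \<noteq> \<psi>" "\<omega> \<noteq> \<psi>'" by blast
    then show ?thesis
    proof cases
      case 1
      then have "e \<omega> = 1" using nonprincipal nonpr' by (auto simp: e_def)
      then show ?thesis using 1 principal_mangoldt_sum_le by (metis add.commute mult_1)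
    next
      case 2
      then have "e \<omega> = -1" using nonprincipal nonpr' neq by (auto simp: e_def)
      then show ?thesis using zero 2 L L' nonprincipal_char_axioms c.nonprincipal_char_axioms by metis
    next
      case 3
      then have e0: "e \<omega> = 0" by (simp add: e_def)
      have np: "nonprincipal_char m \<omega>" using that 3(1) by (simp add: nonprincipal_char_def nonprincipal_char_axioms_def)
      show ?thesis
      proof (cases "L_one \<omega> = 0")
        case True
        then obtain C where C: "\<And>x. x \<ge> 1 \<Longrightarrow> Re (mangoldt_char_sum \<omega> x) \<le> C + - 1 * ln (real x)"
          using zero np by blast
        have "Re (mangoldt_char_sum \<omega> x) \<le> C + e \<omega> * ln (real x)" if "x \<ge> 1" for x
        proof -
          have "ln (real x) \<ge> 0" using that by (intro ln_ge_zero) simp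
          then show ?thesis using C[OF that] e0 by simp
        qed
        then show ?thesis by blast
      next
        case False
        then obtain C where C: "\<And>x. norm (mangoldt_char_sum \<omega> x) \<le> C"
          using nonprincipal_char.mangoldt_char_sum_bounded_if_L_one_nonzero[OF np] by blast
        have "Re (mangoldt_char_sum \<omega> x) \<le> C + e \<omega> * ln (real x)" for x
          using C[of x] complex_Re_le_cmod[of "mangoldt_char_sum \<omega> x"] e0 by simp
        then show ?thesis by blast
      qed
    qed
  qed
  then obtain C where C: "\<And>\<omega> x. dirichlet_char m \<omega> \<Longrightarrow> x \<ge> 1 \<Longrightarrow> Re (mangoldt_char_sum \<omega> x) \<le> C \<omega> + e \<omega> * ln (real x)"
    by metis
  note fin = finite_dirichlet_chars[OF modulus_pos]
  have mem: "principal_char m \<in> dirichlet_chars m" "\<psi> \<in> dirichlet_chars m" "\<psi>' \<in> dirichlet_chars m"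
    using dirichlet_char_principal[OF modulus_pos] dirichlet_char_axioms c.dirichlet_char_axioms
    by (auto simp: dirichlet_chars_def)
  have sum_e: "(\<Sum>\<omega>\<in>dirichlet_chars m. e \<omega>) = -1"
    unfolding e_def sum_subtractf using fin mem by simp
  have "ln (real x) \<le> (\<Sum>\<omega>\<in>dirichlet_chars m. C \<omega>)" if "x \<ge> 1" for x
  proof -
    have "(\<Sum>\<omega>\<in>dirichlet_chars m. \<omega> 1 * mangoldt_char_sum \<omega> x) = (\<Sum>\<omega>\<in>dirichlet_chars m. mangoldt_char_sum \<omega> x)"
      by (intro sum.cong) (auto simp: dirichlet_chars_def dirichlet_char.one)
    then have "Re (\<Sum>\<omega>\<in>dirichlet_chars m. mangoldt_char_sum \<omega> x) \<ge> 0"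
      using dirichlet_chars_orthogonality[OF modulus_pos, of 1 1 x]
      by (simp add: sum_nonneg mangoldt_nonneg)
    also have "Re (\<Sum>\<omega>\<in>dirichlet_chars m. mangoldt_char_sum \<omega> x) \<le> (\<Sum>\<omega>\<in>dirichlet_chars m. C \<omega> + e \<omega> * ln (real x))"
      unfolding Re_sum using C that by (intro sum_mono) (auto simp: dirichlet_chars_def)
    also have "\<dots> = (\<Sum>\<omega>\<in>dirichlet_chars m. C \<omega>) - ln (real x)"
      by (simp add: sum.distrib sum_distrib_right [symmetric] sum_e)
    finally show ?thesis by simp
  qed
  then show False using ln_unbounded by blast
qed

text \<open>Dirichlet's theorem. Finitely many primes in the class would bound
  \<open>\<Sum>n\<le>x, n \<equiv> a. \<Lambda>(n) / n\<close>. By orthogonality this sum is, up to the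
  factor \<open>card (dirichlet_chars m)\<close>, the contribution \<open>ln x + O(1)\<close> of the principal
  character plus bounded contributions of the others.\<close>

lemma infinite_primes_in_residue_class:
  fixes a m :: nat
  assumes m: "m > 0" and a: "coprime a m"
  shows "infinite {p. prime p \<and> [p = a] (mod m)}"
proof
  assume fin: "finite {p. prime p \<and> [p = a] (mod m)}"
  let ?f = "\<lambda>n. mangoldt n / real n" and ?X = "dirichlet_chars m"
  have f0: "?f n \<ge> 0" for n by (simp add: mangoldt_nonneg)
  obtain b where b: "[a * b = 1] (mod m)" using cong_solve_coprime_nat[OF a] by auto
  have cop_b: "coprime b m" using b by (metis cong_imp_coprime cong_sym coprime_1_left coprime_mult_left_iff)
  have "\<exists>C. \<forall>x. norm (mangoldt_char_sum \<psi> x) \<le> C" if "\<psi> \<in> ?X - {principal_char m}" for \<psi>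
  proof -
    have "nonprincipal_char m \<psi>" using that
      by (simp add: nonprincipal_char_def nonprincipal_char_axioms_def dirichlet_chars_def)
    then show ?thesis using nonprincipal_char.mangoldt_char_sum_bounded_if_L_one_nonzero L_one_nonzero by blast
  qed
  then obtain C where C: "\<And>\<psi> x. \<psi> \<in> ?X - {principal_char m} \<Longrightarrow> norm (mangoldt_char_sum \<psi> x) \<le> C \<psi>"
    by metis
  obtain C0 where C0: "\<And>x. x \<ge> 1 \<Longrightarrow> ln (real x) - C0 \<le> Re (mangoldt_char_sum (principal_char m) x)"
    using principal_mangoldt_sum_ge[OF m] by blast
  obtain B where B: "\<And>x. (\<Sum>n | n \<in> {1..x} \<and> \<not> prime n. ?f n) \<le> B"
    using sum_mangoldt_nonprime_bounded by blast
  define K where "K = B + (\<Sum>n | prime n \<and> [n = a] (mod m). ?f n)"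
  have "ln (real x) \<le> C0 + (\<Sum>\<psi>\<in>?X - {principal_char m}. C \<psi>) + real (card ?X) * K" if x: "x \<ge> 1" for x
  proof -
    let ?A = "\<Sum>n | n \<in> {1..x} \<and> [n = a] (mod m). ?f n"
    let ?R = "\<Sum>\<psi>\<in>?X - {principal_char m}. \<psi> b * mangoldt_char_sum \<psi> x"
    have "?A \<le> (\<Sum>n\<in>{n. n \<in> {1..x} \<and> \<not> prime n} \<union> {n. prime n \<and> [n = a] (mod m)}. ?f n)"
      using f0 fin by (intro sum_mono2) auto
    also have "\<dots> \<le> K" unfolding K_def
      using f0 fin B[of x] by (intro order.trans[OF sum_Un_le_nonneg]) auto
    finally have A: "?A \<le> K" .
    have "of_nat (card ?X) * complex_of_real ?A = (\<Sum>\<psi>\<in>?X. \<psi> b * mangoldt_char_sum \<psi> x)"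
      using dirichlet_chars_orthogonality[OF m b] by simp
    also have "\<dots> = principal_char m b * mangoldt_char_sum (principal_char m) x + ?R"
      using finite_dirichlet_chars[OF m] dirichlet_char_principal[OF m]
      by (intro sum.remove) (auto simp: dirichlet_chars_def)
    also have "principal_char m b = 1" using cop_b by (simp add: principal_char_def)
    finally have "Re (of_nat (card ?X) * complex_of_real ?A) = Re (mangoldt_char_sum (principal_char m) x) + Re ?R"
      by simp
    then have "Re (mangoldt_char_sum (principal_char m) x) = real (card ?X) * ?A - Re ?R" by simp
    moreover have "norm ?R \<le> (\<Sum>\<psi>\<in>?X - {principal_char m}. C \<psi>)"
    proof (rule sum_norm_le)
      fix \<psi> assume \<psi>: "\<psi> \<in> ?X - {principal_char m}"
      then have "norm (\<psi> b) \<le> 1" using dirichlet_char.norm_le_1[of m \<psi>] by (simp add: dirichlet_chars_def)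
      then have "norm (\<psi> b) * norm (mangoldt_char_sum \<psi> x) \<le> 1 * C \<psi>"
        using C[OF \<psi>] by (intro mult_mono) auto
      then show "norm (\<psi> b * mangoldt_char_sum \<psi> x) \<le> C \<psi>" by (simp add: norm_mult)
    qed
    moreover have "real (card ?X) * ?A \<le> real (card ?X) * K" using A by (intro mult_left_mono) auto
    ultimately show ?thesis using C0[OF x] abs_Re_le_cmod[of ?R] by linarith
  qed
  then show False using ln_unbounded by blast
qed

section \<open>Matrices of size two over a finite field\<close>

lemma of_nat_CARD_eq_0: "of_nat CARD('k::{field,finite}) = (0::'k)"
  using CHAR_dvd_CARD[where 'a = 'k] by (simp add: of_nat_eq_0_iff_char_dvd)

text \<open>Fermat's argument: multiplication by \<open>x \<noteq> 0\<close> permutes the nonzero elements, so it does not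
  change their product.\<close>

lemma power_CARD_eq_same: "(x::'k::{field,finite}) ^ CARD('k) = x"
proof (cases "x = 0")
  case False
  have "x * (\<Prod>y\<in>UNIV-{0}. x * y) = x * x ^ (CARD('k) - 1) * \<Prod>(UNIV-{0})"
    by (simp add: prod.distrib mult_ac)
  also have "x * x ^ (CARD('k) - 1) = x ^ Suc (CARD('k) - 1)"
    by (subst power_Suc) auto
  also have "Suc (CARD('k) - 1) = CARD('k)"
    using finite_UNIV_card_ge_0[where ?'a = 'k] by simp
  also have "(\<Prod>y\<in>UNIV-{0}. x * y) = (\<Prod>y\<in>UNIV-{0}. y)"
    by (rule prod.reindex_bij_witness[of _ "\<lambda>y. y / x" "\<lambda>y. x * y"]) (use False in auto)
  finally show ?thesis by simp
qed (use finite_UNIV_card_ge_0[where ?'a = 'k] in auto)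

lemma two_neq_0_of_odd_CARD: "odd CARD('k::{field,finite}) \<Longrightarrow> (2::'k) \<noteq> 0"
proof
  assume "odd CARD('k)" "(2::'k) = 0"
  then obtain l where "CARD('k) = 2 * l + 1" by (elim oddE)
  then have "of_nat CARD('k) = (2::'k) * of_nat l + 1" by simp
  then show False using \<open>(2::'k) = 0\<close> of_nat_CARD_eq_0[where 'k = 'k] by simp
qed

lemmas mat2_simps = vec_eq_iff forall_2 matrix_matrix_mult_def matrix_vector_mult_def mat_def sum_2

lemma scalar_mat2_iff: "(\<exists>c. A = mat c) \<longleftrightarrow> A$1$2 = 0 \<and> A$2$1 = 0 \<and> A$1$1 = A$2$2"
  for A :: "'k::field^2^2"
  by (auto simp: mat2_simps)

lemma mat_mult_vector: "mat c *v v = c *s v" for v :: "'k::field^2"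
  by (simp add: mat2_simps)

lemma mat_commute: "mat c ** A = A ** mat c" for A :: "'k::field^2^2"
  by (simp add: mat2_simps mult.commute)

lemma mat_mult_mat: "mat a ** mat b = (mat (a * b) :: 'k::field^2^2)"
  by (simp add: mat2_simps)

text \<open>A nonscalar matrix of size two is cyclic, so its centraliser consists of the polynomials
  in it, which have degree at most one by the Cayley-Hamilton theorem. The proof
  reads the coefficient \<open>b\<close> off an entry that witnesses nonscalarity.\<close>

lemma commuting_with_nonscalar_mat2:
  fixes A B :: "'k::field^2^2"
  assumes "\<nexists>c. A = mat c" "A ** B = B ** A"
  shows "\<exists>a b. B = mat a + mat b ** A"
proof -
  define p q r s where "p = A$1$1" "q = A$1$2" "r = A$2$1" "s = A$2$2"
  define x y z w where "x = B$1$1" "y = B$1$2" "z = B$2$1" "w = B$2$2"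
  note defs = p_q_r_s_def x_y_z_w_def
  have eqs: "q * z = y * r" "p * y + q * w = x * q + y * s" "r * x + s * z = z * p + w * r"
  proof -
    have "p * x + q * z = x * p + y * r" "p * y + q * w = x * q + y * s" "r * x + s * z = z * p + w * r"
      using assms(2) unfolding mat2_simps by (simp_all add: defs)
    then show "q * z = y * r" "p * y + q * w = x * q + y * s" "r * x + s * z = z * p + w * r"
      by (simp_all add: mult.commute)
  qed
  have concl: "\<exists>a b. B = mat a + mat b ** A" if "y = b * q" "z = b * r" "x - w = b * (p - s)" for b
    using that by (intro exI[of _ "x - b * p"] exI[of _ b]) (simp add: mat2_simps defs algebra_simps)
  from assms(1) consider "q \<noteq> 0" | "r \<noteq> 0" | "q = 0" "r = 0" "p \<noteq> s"
    unfolding scalar_mat2_iff defs by blast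
  then show ?thesis
  proof cases
    case 1
    show ?thesis
    proof (rule concl[of "y / q"])
      have "q * (x - w) = y * (p - s)" using eqs(2) by (simp add: algebra_simps)
      then show "x - w = y / q * (p - s)" using 1 by (simp add: field_simps)
    qed (use 1 eqs(1) in \<open>simp_all add: field_simps\<close>)
  next
    case 2
    show ?thesis
    proof (rule concl[of "z / r"])
      have "r * (x - w) = z * (p - s)" using eqs(3) by (simp add: algebra_simps)
      then show "x - w = z / r * (p - s)" using 2 by (simp add: field_simps)
    qed (use 2 eqs(1) in \<open>simp_all add: field_simps\<close>)
  next
    case 3
    then have "y * (p - s) = 0" "z * (p - s) = 0" using eqs(2,3) by (simp_all add: algebra_simps)
    then have "y = 0" "z = 0" using 3(3) by auto
    then show ?thesis using 3 by (intro concl[of "(x - w) / (p - s)"]) auto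
  qed
qed

text \<open>The Cayley-Hamilton theorem in dimension two.\<close>

lemma mat2_square: "A ** A = mat (trace A) ** A - mat (det A)" for A :: "'k::field^2^2"
  by (simp add: mat2_simps trace_def det_2 algebra_simps)

lemma trace_eq_0_of_square_scalar:
  fixes A :: "'k::field^2^2"
  assumes "A ** A = mat c" "\<nexists>c. A = mat c"
  shows "trace A = 0"
proof (rule ccontr)
  assume t: "trace A \<noteq> 0"
  have "mat (trace A) ** A = mat c + mat (det A)" using mat2_square[of A] assms(1) by simp
  also have "\<dots> = mat (c + det A)" by (simp add: mat2_simps)
  finally have "mat (trace A) ** A = mat (c + det A)" .
  then have "mat (1 / trace A) ** (mat (trace A) ** A) = mat (1 / trace A * (c + det A))" by (simp only: mat_mult_mat)
  then have "A = mat (1 / trace A * (c + det A))" using t by (simp add: matrix_mul_assoc mat_mult_mat)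
  then show False using assms(2) by blast
qed

text \<open>The three equations form a linear system in \<open>a\<close>, \<open>b\<close>, \<open>c\<close> whose determinant is, up to
  sign, the homogeneous Vandermonde product \<open>?d\<close>; the displayed identities are Cramer's rule.\<close>

lemma binary_quadratic_form_three_zeros:
  fixes a b c x0 x1 x2 y0 y1 y2 :: "'k::field"
  assumes Q: "a * (x0 * x0) + b * (x0 * y0) - c * (y0 * y0) = 0"
      "a * (x1 * x1) + b * (x1 * y1) - c * (y1 * y1) = 0"
      "a * (x2 * x2) + b * (x2 * y2) - c * (y2 * y2) = 0"
    and D: "x0 * y1 - x1 * y0 \<noteq> 0" "x0 * y2 - x2 * y0 \<noteq> 0" "x1 * y2 - x2 * y1 \<noteq> 0"
  shows "a = 0" "b = 0" "c = 0"
proof -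
  let ?d = "(x0 * y1 - x1 * y0) * (x0 * y2 - x2 * y0) * (x1 * y2 - x2 * y1)"
  let ?Q = "\<lambda>x y. a * (x * x) + b * (x * y) - c * (y * y)"
  have "a * ?d = ?Q x0 y0 * (y1 * y2 * (x1 * y2 - x2 * y1)) - ?Q x1 y1 * (y0 * y2 * (x0 * y2 - x2 * y0))
      + ?Q x2 y2 * (y0 * y1 * (x0 * y1 - x1 * y0))" by (simp add: algebra_simps)
  moreover have "b * ?d = ?Q x1 y1 * (x0 * x0 * y2 * y2 - x2 * x2 * y0 * y0)
      - ?Q x0 y0 * (x1 * x1 * y2 * y2 - x2 * x2 * y1 * y1)
      - ?Q x2 y2 * (x0 * x0 * y1 * y1 - x1 * x1 * y0 * y0)" by (simp add: algebra_simps)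
  moreover have "- c * ?d = ?Q x0 y0 * (x1 * x2 * (x1 * y2 - x2 * y1)) - ?Q x1 y1 * (x0 * x2 * (x0 * y2 - x2 * y0))
      + ?Q x2 y2 * (x0 * x1 * (x0 * y1 - x1 * y0))" by (simp add: algebra_simps)
  ultimately show "a = 0" "b = 0" "c = 0" unfolding Q using D by auto
qed

text \<open>Eigenvectors \<open>(x, y)\<close> of \<open>G\<close> are zeros of the quadratic form that expresses
  proportionality of \<open>G (x, y)\<close> to \<open>(x, y)\<close>. Three pairwise independent zeros make the
  form vanish identically, which means that \<open>G\<close> is scalar.\<close>

lemma three_eigenlines_imp_scalar:
  fixes G :: "'k::field^2^2"
  assumes eig: "\<And>i. i < 3 \<Longrightarrow> \<exists>c. G *v w i = c *s w i" and nz: "\<And>i. i < 3 \<Longrightarrow> w i \<noteq> 0"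
    and indep: "\<And>i j. i < j \<Longrightarrow> j < (3::nat) \<Longrightarrow> \<nexists>c. w j = c *s w i"
  shows "\<exists>c. G = mat c"
proof -
  define x y where "x = (\<lambda>i. w i $ 1)" "y = (\<lambda>i. w i $ 2)"
  define a b c where "a = G$2$1" "b = G$2$2 - G$1$1" "c = G$1$2"
  have Q: "a * (x i * x i) + b * (x i * y i) - c * (y i * y i) = 0" if i: "i < 3" for i
  proof -
    obtain l where "G *v w i = l *s w i" using eig[OF i] by blast
    then have e: "G$1$1 * x i + G$1$2 * y i = l * x i" "G$2$1 * x i + G$2$2 * y i = l * y i"
      by (simp_all add: mat2_simps x_y_def)
    have "a * (x i * x i) + b * (x i * y i) - c * (y i * y i)
        = x i * (G$2$1 * x i + G$2$2 * y i) - y i * (G$1$1 * x i + G$1$2 * y i)"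
      by (simp add: a_b_c_def algebra_simps)
    then show ?thesis unfolding e by (simp add: mult.left_commute)
  qed
  have D: "x i * y j - x j * y i \<noteq> 0" if "i < j" "j < 3" for i j
  proof
    assume 0: "x i * y j - x j * y i = 0"
    have "x i \<noteq> 0 \<or> y i \<noteq> 0" using nz[of i] that by (auto simp: vec_eq_iff forall_2 x_y_def)
    then have "\<exists>c. x j = c * x i \<and> y j = c * y i"
    proof
      assume "x i \<noteq> 0"
      then show ?thesis using 0 by (intro exI[of _ "x j / x i"]) (simp add: field_simps)
    next
      assume "y i \<noteq> 0"
      then show ?thesis using 0 by (intro exI[of _ "y j / y i"]) (simp add: field_simps)
    qed
    then show False using indep[OF that] by (auto simp: vec_eq_iff forall_2 x_y_def)
  qed
  have "a = 0 \<and> b = 0 \<and> c = 0"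
    using binary_quadratic_form_three_zeros[OF Q[of 0] Q[of 1] Q[of 2] D[of 0 1] D[of 0 2] D[of 1 2]] by simp
  then show ?thesis unfolding scalar_mat2_iff a_b_c_def by simp
qed

text \<open>As \<open>j\<close> is traceless, \<open>r = a + b j\<close> and \<open>s = a' + b' j\<close>. Taking traces in
  \<open>A r A\<^sup>-\<^sup>1 = c s\<close> gives \<open>2 a = 2 c a'\<close>; removing the scalar parts leaves
  \<open>b A j = c b' j A\<close> with \<open>b \<noteq> 0\<close>.\<close>

lemma conjugate_traceless_part:
  fixes A r s j :: "'k::field^2^2"
  assumes two: "(2::'k) \<noteq> 0" and A: "invertible A"
    and j: "j ** j = mat e" "\<nexists>c. j = mat c"
    and r: "r ** j = j ** r" "\<nexists>c. r = mat c" and s: "s ** j = j ** s"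
    and conj: "A ** r = mat c ** (s ** A)"
  shows "\<exists>d. A ** j = mat d ** (j ** A)"
proof -
  obtain A' where A': "A ** A' = mat 1" using A unfolding invertible_def by blast
  obtain a b where ab: "r = mat a + mat b ** j" using commuting_with_nonscalar_mat2[OF j(2), of r] r(1) by metis
  obtain a' b' where ab': "s = mat a' + mat b' ** j" using commuting_with_nonscalar_mat2[OF j(2), of s] s by metis
  have b: "b \<noteq> 0"
  proof
    assume "b = 0"
    then have "r = mat a" unfolding ab by (simp add: mat2_simps)
    then show False using r(2) by blast
  qed
  have tj: "trace j = 0" using trace_eq_0_of_square_scalar[OF j] .
  then have tj2: "j$2$2 = - j$1$1" by (simp add: trace_def sum_2 add_eq_0_iff)
  have "(A ** r) ** A' = mat c ** s"
    unfolding conj using A' by (simp flip: matrix_mul_assoc)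
  then have "trace (mat c ** s) = trace (A' ** (A ** r))" by (metis trace_mul_sym)
  also have "A' ** (A ** r) = r" using A' matrix_left_right_inverse[of A A'] by (simp add: matrix_mul_assoc)
  finally have "2 * (c * a') = 2 * a"
    unfolding ab ab' using tj2 by (simp add: mat2_simps trace_def algebra_simps)
  then have ca: "a = c * a'" using two by simp
  have "mat b ** (A ** j) = mat (c * b') ** (j ** A)"
    using conj unfolding ab ab' ca
    by (simp add: mat2_simps algebra_simps)
  then have "mat (1 / b) ** (mat b ** (A ** j)) = mat (1 / b) ** (mat (c * b') ** (j ** A))" by simp
  then have "A ** j = mat (1 / b * (c * b')) ** (j ** A)" using b by (simp add: matrix_mul_assoc mat_mult_mat)
  then show ?thesis by blast
qed

lemma invertible_mat2: "invertible (mat c :: 'k::field^2^2) \<longleftrightarrow> c \<noteq> 0"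
  by (simp add: invertible_det_nz det_2 mat_def)

abbreviation mpow :: "'k::field^2^2 \<Rightarrow> nat \<Rightarrow> 'k^2^2" where
  "mpow A k \<equiv> A [^]\<^bsub>GL2\<^esub> k"

lemma GL2_simps [simp]:
  "carrier GL2 = {A. invertible A}" "\<one>\<^bsub>GL2\<^esub> = mat 1" "A \<otimes>\<^bsub>GL2\<^esub> B = A ** B"
  by (simp_all add: GL2_def)

lemma mpow_add: "mpow A (i + k) = mpow A i ** mpow A k"
  by (induction k) (simp_all add: matrix_mul_assoc)

lemma mpow_commute: "mpow A i ** mpow A k = mpow A k ** mpow A i"
  by (simp flip: mpow_add add: add.commute)

lemma invertible_mpow: "invertible A \<Longrightarrow> invertible (mpow A k)"
  by (induction k) (simp_all add: invertible_mat2 invertible_mult)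

text \<open>Subtracting the eigenvalue \<open>l\<close> gives a singular \<open>N\<close>, so \<open>N\<^sup>2 = t N\<close> with \<open>t\<close> its
  trace, and \<open>r^k = l^k + c k \<cdot> N\<close> where \<open>t \<cdot> c k = (l + t)^k - l^k\<close>. For \<open>k = q\<close> the
  identity \<open>x^q = x\<close> yields \<open>c q = 1\<close> if \<open>t \<noteq> 0\<close>, and \<open>c q = q l^(q-1) = 0\<close> if
  \<open>t = 0\<close>. Both the diagonalisable and the unipotent case are covered without a change
  of basis.\<close>

lemma mpow_CARD_of_eigenvector:
  fixes r :: "'k::{field,finite}^2^2"
  assumes eig: "r *v v = l *s v" "v \<noteq> 0"
  shows "(\<exists>c. mpow r CARD('k) = mat c) \<or> mpow r CARD('k) = r"
proof -
  define N where "N = r - mat l"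
  define t where "t = trace N"
  have r: "r = mat l + N" by (simp add: N_def)
  have Nv: "N *v v = 0" using eig(1) by (simp add: N_def mat2_simps algebra_simps)
  have "det N = 0"
  proof (rule ccontr)
    assume "det N \<noteq> 0"
    then obtain N' where "N' ** N = mat 1" unfolding invertible_det_nz[symmetric] invertible_def by blast
    then have "v = N' *v (N *v v)" by (simp add: matrix_vector_mul_assoc)
    then show False using eig(2) Nv by simp
  qed
  then have NN: "N ** N = mat t ** N" using mat2_square[of N] by (simp add: t_def)
  define c where "c = rec_nat 0 (\<lambda>k c. l ^ k + c * (l + t))"
  have c: "c 0 = 0" "c (Suc k) = l ^ k + c k * (l + t)" for k by (simp_all add: c_def)
  have pow: "mpow r k = mat (l ^ k) + mat (c k) ** N" for k
  proof (induction k)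
    case (Suc k)
    have "mpow r (Suc k) = (mat (l ^ k) + mat (c k) ** N) ** (mat l + N)" using Suc r by simp
    also have "\<dots> = mat (l ^ Suc k) + mat (l ^ k + c k * l) ** N + mat (c k) ** (N ** N)"
      by (simp add: mat2_simps algebra_simps)
    also have "\<dots> = mat (l ^ Suc k) + mat (c (Suc k)) ** N"
      unfolding NN c by (simp add: mat2_simps algebra_simps)
    finally show ?case .
  qed (simp add: c mat2_simps)
  show ?thesis
  proof (cases "t = 0")
    case True
    have "c (Suc k) = of_nat (Suc k) * l ^ k" for k
      by (induction k) (simp_all add: c True algebra_simps)
    then have "c CARD('k) = of_nat CARD('k) * l ^ (CARD('k) - 1)"
      using finite_UNIV_card_ge_0[where ?'a = 'k] by (metis Suc_diff_1 finite)
    then have "c CARD('k) = 0" by (simp add: of_nat_CARD_eq_0)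
    then have "mpow r CARD('k) = mat (l ^ CARD('k))" unfolding pow by (simp add: mat2_simps)
    then show ?thesis by blast
  next
    case False
    have tc: "t * c k = (l + t) ^ k - l ^ k" for k
    proof (induction k)
      case (Suc k)
      have "t * c (Suc k) = t * l ^ k + (t * c k) * (l + t)" by (simp add: c algebra_simps)
      also have "\<dots> = (l + t) ^ Suc k - l ^ Suc k" unfolding Suc by (simp add: algebra_simps)
      finally show ?case .
    qed (simp add: c)
    from tc[of "CARD('k)"] have "c CARD('k) = 1" using False by (simp add: power_CARD_eq_same)
    then have "mpow r CARD('k) = mat l + mat 1 ** N" using pow[of "CARD('k)"] by (simp add: power_CARD_eq_same)
    also have "\<dots> = r" by (simp add: N_def)
    finally have "mpow r CARD('k) = r" .
    then show ?thesis by blast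
  qed
qed

section \<open>The projective linear group and the projective line\<close>

lemma group_GL2: "group (GL2 :: ('k::field^2^2) monoid)"
proof (rule groupI)
  fix A :: "'k^2^2" assume "A \<in> carrier GL2"
  then obtain B where "A ** B = mat 1" "B ** A = mat 1" by (auto simp: invertible_def)
  then show "\<exists>B\<in>carrier GL2. B \<otimes>\<^bsub>GL2\<^esub> A = \<one>\<^bsub>GL2\<^esub>"
    by (intro bexI[of _ B]) (auto simp: invertible_def)
qed (auto simp: invertible_mult invertible_mat2 matrix_mul_assoc)

lemma normal_scalars2: "scalars2 \<lhd> (GL2 :: ('k::field^2^2) monoid)"
proof -
  interpret group "GL2 :: ('k^2^2) monoid" by (rule group_GL2)
  have inv_mat: "inv\<^bsub>GL2\<^esub> (mat c) = mat (1 / c)" if "c \<noteq> (0::'k)" for c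
    using that by (intro inv_equality) (auto simp: invertible_mat2 mat_mult_mat)
  have "subgroup scalars2 (GL2 :: ('k^2^2) monoid)"
  proof (rule subgroupI)
    show "scalars2 \<noteq> {}" unfolding scalars2_def by (auto intro: exI[of _ 1])
  next
    fix A :: "'k^2^2" assume "A \<in> scalars2"
    then show "inv\<^bsub>GL2\<^esub> A \<in> scalars2" by (force simp: scalars2_def inv_mat)
  next
    fix A B :: "'k^2^2" assume "A \<in> scalars2" "B \<in> scalars2"
    then show "A \<otimes>\<^bsub>GL2\<^esub> B \<in> scalars2" by (force simp: scalars2_def mat_mult_mat)
  qed (auto simp: scalars2_def invertible_mat2)
  moreover have "scalars2 #>\<^bsub>GL2\<^esub> A = A <#\<^bsub>GL2\<^esub> scalars2" for A :: "'k^2^2"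
    by (auto simp: r_coset_def l_coset_def scalars2_def mat_commute)
  ultimately show ?thesis by (intro normalI) auto
qed

text \<open>The coset of \<open>A\<close> modulo scalars, written with matrix products;
  \<open>pgl_class_coset\<close> identifies it with the coset in the group \<open>GL2\<close>.\<close>

definition pgl_class :: "'k::field^2^2 \<Rightarrow> 'k pgl2" where
  "pgl_class A = {mat c ** A | c. c \<noteq> 0}"

lemma pgl_class_coset: "pgl_class A = scalars2 #>\<^bsub>GL2\<^esub> A"
  by (auto simp: pgl_class_def r_coset_def scalars2_def)

lemma group_PGL2: "group (PGL2 :: 'k::field pgl2 monoid)"
  unfolding PGL2_def using normal_scalars2 by (rule normal.factorgroup_is_group)

lemma pgl_class_hom: "pgl_class \<in> hom (GL2 :: ('k::field^2^2) monoid) PGL2"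
  unfolding PGL2_def pgl_class_coset[abs_def]
  using normal.r_coset_hom_Mod[OF normal_scalars2] by simp

lemma group_hom_pgl_class: "group_hom GL2 (PGL2 :: 'k::field pgl2 monoid) pgl_class"
  using group_GL2 group_PGL2 pgl_class_hom by (simp add: group_hom_def group_hom_axioms_def)

lemma carrier_PGL2E:
  assumes "M \<in> carrier (PGL2 :: 'k::field pgl2 monoid)"
  obtains A where "invertible A" "M = pgl_class A"
  using assms unfolding PGL2_def FactGroup_def RCOSETS_def pgl_class_coset by auto

lemma pgl_class_mult:
  "invertible A \<Longrightarrow> invertible B \<Longrightarrow> pgl_class A \<otimes>\<^bsub>PGL2\<^esub> pgl_class B = pgl_class (A ** B)"
  using hom_mult[OF pgl_class_hom, of A B] by simp

lemma pgl_class_mpow: "invertible A \<Longrightarrow> pgl_class A [^]\<^bsub>PGL2\<^esub> k = pgl_class (mpow A k)" for k :: nat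
  using group_hom.hom_nat_pow[OF group_hom_pgl_class, of A k] by simp

lemma pgl_class_eq_iff: "pgl_class A = pgl_class B \<longleftrightarrow> (\<exists>c. c \<noteq> 0 \<and> A = mat c ** B)"
proof
  assume "pgl_class A = pgl_class B"
  moreover have "A \<in> pgl_class A" unfolding pgl_class_def by (auto intro: exI[of _ 1])
  ultimately show "\<exists>c. c \<noteq> 0 \<and> A = mat c ** B" unfolding pgl_class_def by auto
next
  assume "\<exists>c. c \<noteq> 0 \<and> A = mat c ** B"
  then obtain c where c: "c \<noteq> 0" "A = mat c ** B" by blast
  have "mat d ** A = mat (d * c) ** B" "mat d ** B = mat (d / c) ** A" for d
    using c by (simp_all add: matrix_mul_assoc mat_mult_mat)
  then show "pgl_class A = pgl_class B" unfolding pgl_class_def using c(1)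
    by (auto; metis divide_eq_0_iff mult_eq_0_iff)
qed

lemma pgl_class_eq_one_iff:
  assumes "invertible (A :: 'k::field^2^2)" shows "pgl_class A = \<one>\<^bsub>PGL2\<^esub> \<longleftrightarrow> (\<exists>c. A = mat c)"
proof -
  have "\<one>\<^bsub>PGL2\<^esub> = pgl_class (mat 1 :: 'k^2^2)"
    using group_hom.hom_one[OF group_hom_pgl_class[where 'k = 'k]] by simp
  then show ?thesis using assms by (auto simp: pgl_class_eq_iff invertible_mat2)
qed

abbreviation line :: "'k::field^2 \<Rightarrow> ('k^2) set" where "line v \<equiv> vec.span {v}"

lemma pgl2_act_line: "pgl2_act (pgl_class A) (line v) = line (A *v v)"
proof -
  have "(mat c ** A) *v (d *s v) = (c * d) *s (A *v v)" for c d
    by (simp add: mat2_simps algebra_simps)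
  then show ?thesis
    unfolding pgl2_act_def pgl_class_def vec.span_singleton
    by (auto simp: image_iff intro: exI[of _ 1]) (metis mat_mult_vector matrix_vector_mul_assoc mult_1 one_neq_zero)
qed

lemma line_eq_iff:
  assumes "v \<noteq> 0" "w \<noteq> 0"
  shows "line v = line w \<longleftrightarrow> (\<exists>c. w = c *s v)"
proof
  assume "line v = line w"
  then have "w \<in> line v" using vec.span_base[of w "{w}"] by simp
  then show "\<exists>c. w = c *s v" by (auto simp: vec.span_singleton)
next
  assume "\<exists>c. w = c *s v"
  then obtain c where c: "w = c *s v" by blast
  then have "c \<noteq> 0" using assms by auto
  then have v: "v = (1 / c) *s w" using c by simp
  have "v \<in> line w" "w \<in> line v" using c v unfolding vec.span_singleton by blast+
  then show "line v = line w" using vec.span_eq[of "{v}" "{w}"] by blast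
qed

text \<open>Every line is spanned by \<open>(0, 1)\<close> or by \<open>(1, t)\<close> for some \<open>t\<close>. The upper bound is enough: a
  regular orbit of \<open>q + 1\<close> points then fills the projective line.\<close>

lemma card_proj_line_le: "card (proj_line :: ('k::{field,finite} ^ 2) set set) \<le> CARD('k) + 1"
proof -
  let ?e = "\<lambda>x y :: 'k. (\<chi> i. if i = 1 then x else y) :: 'k^2"
  have "line v \<in> insert (line (?e 0 1)) ((\<lambda>t. line (?e 1 t)) ` UNIV)" if "v \<noteq> 0" for v :: "'k^2"
  proof (cases "v $ 1 = 0")
    case True
    then have "v = (v $ 2) *s ?e 0 1" by (simp add: vec_eq_iff forall_2)
    moreover have "?e 0 1 \<noteq> 0" by (simp add: vec_eq_iff forall_2)
    ultimately have "line (?e 0 1) = line v" using that line_eq_iff by blast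
    then show ?thesis by simp
  next
    case False
    then have "v = (v $ 1) *s ?e 1 (v $ 2 / v $ 1)" by (simp add: vec_eq_iff forall_2)
    moreover have "?e 1 (v $ 2 / v $ 1) \<noteq> 0" by (simp add: vec_eq_iff forall_2)
    ultimately have "line (?e 1 (v $ 2 / v $ 1)) = line v" using that line_eq_iff by blast
    then show ?thesis by blast
  qed
  then have "proj_line \<subseteq> insert (line (?e 0 1)) ((\<lambda>t. line (?e 1 t)) ` UNIV)"
    unfolding proj_line_def by blast
  then have "card (proj_line :: ('k^2) set set) \<le> card (insert (line (?e 0 1)) ((\<lambda>t. line (?e 1 t)) ` UNIV))"
    by (intro card_mono) auto
  also have "\<dots> \<le> Suc (card ((\<lambda>t. line (?e 1 t)) ` UNIV))" by (simp add: card_insert_if)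
  also have "\<dots> \<le> Suc CARD('k)" using card_image_le[of UNIV "\<lambda>t. line (?e 1 t)"] by simp
  finally show ?thesis by simp
qed

lemma invertible_mult_vector_eq_0_iff: "invertible A \<Longrightarrow> A *v v = 0 \<longleftrightarrow> v = 0" for A :: "'k::field^2^2"
  by (metis invertible_def matrix_vector_mul_assoc matrix_vector_mul_lid matrix_vector_mult_0_right)

lemma matrix_mult_smult: "A *v (c *s v) = c *s (A *v v)" for A :: "'k::field^2^2"
  by (simp add: mat2_simps algebra_simps)

section \<open>Permutations induced on a Singer cycle\<close>

text \<open>A matrix \<open>r\<close> whose class has order exactly \<open>n = q + 1\<close> in the projective group, and a
  vector \<open>v0\<close> spanning the base point.\<close>

locale singer =
  fixes r :: "'k::{field,finite}^2^2" and v0 :: "'k^2" and n :: nat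
  assumes r_inv: "invertible r" and v0: "v0 \<noteq> 0" and n: "n = CARD('k) + 1"
    and scalar_iff: "(\<exists>c. mpow r k = mat c) \<longleftrightarrow> n dvd k"
begin

lemma n_ge_3: "n \<ge> 3"
proof -
  have "card {0, 1 :: 'k} \<le> CARD('k)" by (intro card_mono) auto
  then show ?thesis by (simp add: n)
qed

definition pt :: "nat \<Rightarrow> 'k^2" where "pt k = mpow r k *v v0"

lemma pt_nonzero: "pt k \<noteq> 0"
  unfolding pt_def using invertible_mpow[OF r_inv] v0 invertible_mult_vector_eq_0_iff by blast

lemma pt_add: "pt (i + k) = mpow r i *v pt k"
  by (simp add: pt_def mpow_add matrix_vector_mul_assoc)

text \<open>An eigenvector would make \<open>r^q\<close> or \<open>r^(q-1)\<close> scalar, but \<open>q + 1\<close> divides neither \<open>q\<close> nor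
  \<open>q - 1\<close>.\<close>

lemma no_eigenvector:
  assumes "v \<noteq> 0" shows "\<nexists>l. r *v v = l *s v"
proof
  assume "\<exists>l. r *v v = l *s v"
  then consider "\<exists>c. mpow r CARD('k) = mat c" | "mpow r CARD('k) = r"
    using mpow_CARD_of_eigenvector assms by blast
  then show False
  proof cases
    case 1
    then have "n dvd CARD('k)" using scalar_iff by blast
    then show False using dvd_imp_le[of n "CARD('k)"] n_ge_3 n by simp
  next
    case 2
    obtain r' where r': "r ** r' = mat 1" using r_inv by (auto simp: invertible_def)
    obtain k where k: "CARD('k) = Suc k" using n_ge_3 n by (metis not0_implies_Suc zero_less_card_finite not_gr_zero)
    then have "mpow r k ** r = r" using 2 by simp
    then have "mpow r k ** r ** r' = r ** r'" by simp
    then have "mpow r k = mat 1" using r' by (simp flip: matrix_mul_assoc)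
    then have "n dvd k" using scalar_iff by blast
    then show False using dvd_imp_le[of n k] n_ge_3 n k by simp
  qed
qed

text \<open>The matrix \<open>r\<close> commutes with its nonscalar power and hence is affine in it, so an
  eigenvector of the power is an eigenvector of \<open>r\<close>.\<close>

lemma nonscalar_power_no_eigenvector:
  assumes "\<not> n dvd k" "v \<noteq> 0" shows "\<nexists>l. mpow r k *v v = l *s v"
proof
  assume "\<exists>l. mpow r k *v v = l *s v"
  then obtain l where l: "mpow r k *v v = l *s v" by blast
  have "mpow r k ** r = r ** mpow r k" using mpow_commute[of r k 1] by simp
  then obtain a b where "r = mat a + mat b ** mpow r k"
    using commuting_with_nonscalar_mat2 scalar_iff assms(1) by blast
  then have "r *v v = a *s v + b *s (mpow r k *v v)"
    by (metis mat_mult_vector matrix_vector_mul_assoc matrix_vector_mult_add_rdistrib)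
  then have "r *v v = (a + b * l) *s v" unfolding l by (simp add: vec_eq_iff algebra_simps)
  then show False using no_eigenvector assms(2) by blast
qed

lemma proportional_pt_le:
  assumes "i \<le> j" shows "(\<exists>c. pt j = c *s pt i) \<longleftrightarrow> n dvd (j - i)"
proof
  assume "\<exists>c. pt j = c *s pt i"
  moreover have "pt j = mpow r (j - i) *v pt i" using pt_add[of "j - i" i] assms by simp
  ultimately show "n dvd (j - i)" using nonscalar_power_no_eigenvector pt_nonzero by metis
next
  assume "n dvd (j - i)"
  then obtain c where "mpow r (j - i) = mat c" using scalar_iff by blast
  moreover have "pt j = mpow r (j - i) *v pt i" using pt_add[of "j - i" i] assms by simp
  ultimately show "\<exists>c. pt j = c *s pt i" using mat_mult_vector by metis
qed

lemma line_pt_eq_iff: "line (pt i) = line (pt j) \<longleftrightarrow> [i = j] (mod n)"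
proof -
  have "line (pt i) = line (pt j) \<longleftrightarrow> [i = j] (mod n)" if "i \<le> j" for i j
    using that proportional_pt_le[OF that] line_eq_iff[OF pt_nonzero pt_nonzero, of i j]
    by (simp add: cong_altdef_nat cong_sym_eq[of i j])
  then show ?thesis by (metis cong_sym_eq nat_le_linear)
qed

text \<open>The \<open>n = q + 1\<close> points of the orbit are distinct and the projective line has at most
  \<open>q + 1\<close> points.\<close>

lemma ex1_pt_on_line:
  assumes "v \<noteq> 0" shows "\<exists>!j. j < n \<and> line v = line (pt j)"
proof -
  have inj: "inj_on (\<lambda>j. line (pt j)) {..<n}"
    by (intro inj_onI) (auto simp: line_pt_eq_iff cong_def)
  have sub: "(\<lambda>j. line (pt j)) ` {..<n} \<subseteq> proj_line" using pt_nonzero by (auto simp: proj_line_def)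
  have fin: "finite (proj_line :: ('k^2) set set)" by simp
  have "(\<lambda>j. line (pt j)) ` {..<n} = proj_line"
    using card_subset_eq[OF fin sub] card_mono[OF fin sub] card_proj_line_le[where 'k = 'k] card_image[OF inj] n by simp
  moreover have "line v \<in> proj_line" using assms by (auto simp: proj_line_def)
  ultimately have "line v \<in> (\<lambda>j. line (pt j)) ` {..<n}" by simp
  then obtain j where j: "j < n" "line v = line (pt j)" by blast
  have "k = j" if "k < n \<and> line v = line (pt k)" for k
    using inj_onD[OF inj, of k j] that j by simp
  then show ?thesis using j by blast
qed

text \<open>The map \<open>F_M\<close> on natural-number representatives, for the class \<open>M\<close> of \<open>A\<close>.\<close>

definition induced :: "'k^2^2 \<Rightarrow> nat \<Rightarrow> nat" where
  "induced A i = (THE j. j < n \<and> line (A *v pt i) = line (pt j))"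

lemma induced:
  assumes "invertible A"
  shows "induced A i < n" "line (A *v pt i) = line (pt (induced A i))"
proof -
  have "A *v pt i \<noteq> 0" using assms pt_nonzero invertible_mult_vector_eq_0_iff by blast
  from theI'[OF ex1_pt_on_line[OF this]]
  show "induced A i < n" "line (A *v pt i) = line (pt (induced A i))" unfolding induced_def by auto
qed

lemma line_mult_cong:
  assumes "invertible A" "v \<noteq> 0" "w \<noteq> 0"
  shows "line (A *v v) = line (A *v w) \<longleftrightarrow> line v = line w"
proof -
  obtain A' where A': "A' ** A = mat 1" using assms(1) by (auto simp: invertible_def)
  then have inj: "A *v x = A *v y \<longleftrightarrow> x = y" for x y by (metis matrix_vector_mul_assoc matrix_vector_mul_lid)
  show ?thesis using assms by (simp add: line_eq_iff invertible_mult_vector_eq_0_iff matrix_mult_smult[symmetric] inj)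
qed

lemma induced_inj:
  assumes "invertible A" shows "inj_on (induced A) {..<n}"
proof (rule inj_onI)
  fix i j assume *: "i \<in> {..<n}" "j \<in> {..<n}" "induced A i = induced A j"
  then have "line (A *v pt i) = line (A *v pt j)" using induced(2)[OF assms] by metis
  then have "[i = j] (mod n)" using line_mult_cong[OF assms pt_nonzero pt_nonzero] line_pt_eq_iff by blast
  then show "i = j" using * by (simp add: cong_def)
qed

text \<open>Here \<open>S\<close> and \<open>A'\<close> are the inverses of \<open>r^v\<close> and \<open>A\<close>. The differential equation says that
  \<open>A r^u\<close> and \<open>r^v A\<close> map the point \<open>pt x\<close> to the same point.\<close>

lemma derivative_eigenvector:
  assumes A: "invertible A" and S: "mpow r v ** S = mat 1" and A': "A' ** A = mat 1"
    and d: "[induced A ((x + u) mod n) = v + induced A x] (mod n)"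
  shows "\<exists>c. (A' ** (S ** (A ** mpow r u))) *v pt x = c *s pt x"
proof -
  have S': "S ** mpow r v = mat 1" using S matrix_left_right_inverse by blast
  let ?y = "(x + u) mod n"
  have nz: "A *v w \<noteq> 0 \<longleftrightarrow> w \<noteq> 0" for w using A invertible_mult_vector_eq_0_iff by blast
  have "line (A *v (mpow r u *v pt x)) = line (A *v pt (x + u))"
    by (simp add: pt_add[symmetric] add.commute)
  also have "\<dots> = line (A *v pt ?y)"
    using line_mult_cong[OF A pt_nonzero pt_nonzero] line_pt_eq_iff by (simp add: cong_def)
  also have "\<dots> = line (pt (induced A ?y))" using induced(2)[OF A] .
  also have "\<dots> = line (pt (v + induced A x))" using d line_pt_eq_iff by blast
  also have "\<dots> = line (mpow r v *v pt (induced A x))" by (simp add: pt_add)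
  also have "\<dots> = line (mpow r v *v (A *v pt x))"
    using line_mult_cong[OF invertible_mpow[OF r_inv]] induced(2)[OF A, of x] pt_nonzero nz by metis
  finally have "line (mpow r v *v (A *v pt x)) = line (A *v (mpow r u *v pt x))" ..
  moreover have "mpow r v *v (A *v pt x) \<noteq> 0" "A *v (mpow r u *v pt x) \<noteq> 0"
    using nz pt_nonzero invertible_mpow[OF r_inv] invertible_mult_vector_eq_0_iff by blast+
  ultimately obtain c where "A *v (mpow r u *v pt x) = c *s (mpow r v *v (A *v pt x))"
    using line_eq_iff by blast
  then have "A' *v (S *v (A *v (mpow r u *v pt x))) = c *s (A' *v (S *v (mpow r v *v (A *v pt x))))"
    by (simp only: matrix_mult_smult)
  moreover have "A' *v (S *v (mpow r v *v (A *v pt x))) = pt x"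
    using S' A' by (metis matrix_vector_mul_assoc matrix_vector_mul_lid)
  ultimately show ?thesis by (auto simp: matrix_vector_mul_assoc matrix_mul_assoc)
qed

text \<open>Three solutions \<open>x 0\<close>, \<open>x 1\<close>, \<open>x 2\<close> are three fixed points, so \<open>A\<close> conjugates \<open>r^u\<close> to
  a scalar multiple of \<open>r^v\<close>. Both lie in the span of the identity and \<open>r^(n/2)\<close>,
  and the latter has a scalar square, so \<open>conjugate_traceless_part\<close> applies.\<close>

lemma derivative_three_solutions:
  assumes odd: "odd CARD('k)" and A: "invertible A" and u: "\<not> n dvd u"
    and x: "\<And>i. i < 3 \<Longrightarrow> x i < n" "\<And>i j. i < j \<Longrightarrow> j < (3::nat) \<Longrightarrow> x i \<noteq> x j"
    and d: "\<And>i. i < 3 \<Longrightarrow> [induced A ((x i + u) mod n) = v + induced A (x i)] (mod n)"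
  shows "\<exists>d. A ** mpow r (n div 2) = mat d ** (mpow r (n div 2) ** A)"
proof -
  obtain S where S: "mpow r v ** S = mat 1" using invertible_mpow[OF r_inv] by (auto simp: invertible_def)
  obtain A' where A': "A ** A' = mat 1" "A' ** A = mat 1" using A by (auto simp: invertible_def)
  let ?G = "A' ** (S ** (A ** mpow r u))"
  have "\<exists>c. ?G = mat c"
  proof (rule three_eigenlines_imp_scalar[where w = "\<lambda>i. pt (x i)"])
    fix i j :: nat assume "i < j" "j < 3"
    then have "\<not> [x i = x j] (mod n)" using x by (auto simp: cong_def)
    then show "\<nexists>c. pt (x j) = c *s pt (x i)" using line_pt_eq_iff line_eq_iff[OF pt_nonzero pt_nonzero] by blast
  qed (use derivative_eigenvector[OF A S A'(2) d] pt_nonzero in auto)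
  then obtain c where c: "?G = mat c" by blast
  have "A ** mpow r u = (mpow r v ** ((A ** A') ** S)) ** (A ** mpow r u)" using A' S by simp
  also have "\<dots> = mpow r v ** (A ** ?G)" by (simp add: matrix_mul_assoc)
  also have "\<dots> = (mpow r v ** A) ** mat c" unfolding c by (simp add: matrix_mul_assoc)
  also have "\<dots> = mat c ** (mpow r v ** A)" by (rule mat_commute [symmetric])
  finally have conj: "A ** mpow r u = mat c ** (mpow r v ** A)" .
  have even: "even n" using odd n by simp
  then have "n div 2 + n div 2 = n" by presburger
  then have "mpow r (n div 2) ** mpow r (n div 2) = mpow r n" using mpow_add[of r "n div 2" "n div 2"] by simp
  moreover have "\<exists>e. mpow r n = mat e" using scalar_iff[of n] by simp
  ultimately obtain e where e: "mpow r (n div 2) ** mpow r (n div 2) = mat e" by metis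
  have "\<not> n dvd n div 2" using n_ge_3 even dvd_imp_le[of n "n div 2"] by auto
  then have nonsc: "\<nexists>c. mpow r (n div 2) = mat c" "\<nexists>c. mpow r u = mat c" using scalar_iff[of "n div 2"] scalar_iff[of u] u by simp_all
  show ?thesis
    by (rule conjugate_traceless_part[OF two_neq_0_of_odd_CARD[OF odd] A e nonsc(1) mpow_commute nonsc(2) mpow_commute conj])
qed

end

text \<open>The maximum is at most \<open>2\<close> by hypothesis. It is attained for \<open>u = 1\<close>: the differences
  \<open>F (x + 1) - F x\<close> are \<open>n\<close> values among the \<open>n - 1\<close> nonzero residues, so two of them
  coincide.\<close>

lemma APN_if_no_three_solutions:
  fixes F :: "int \<Rightarrow> int"
  assumes n: "n \<ge> 2"
    and F: "inj_on F {0..<int n}" "F ` {0..<int n} \<subseteq> {0..<int n}"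
    and three: "\<And>u v a b c. u \<in> {0<..<int n} \<Longrightarrow> v \<in> {0..<int n} \<Longrightarrow> {a, b, c} \<subseteq> {0..<int n} \<Longrightarrow>
      a \<noteq> b \<Longrightarrow> a \<noteq> c \<Longrightarrow> b \<noteq> c \<Longrightarrow> (F ((a + u) mod int n) - F a) mod int n = v \<Longrightarrow>
      (F ((b + u) mod int n) - F b) mod int n = v \<Longrightarrow>
      (F ((c + u) mod int n) - F c) mod int n = v \<Longrightarrow> False"
  shows "APN n F"
proof -
  define Z where "Z = residue_ring (int n)"
  interpret residues "int n" Z using n by unfold_locales (auto simp: Z_def)
  have carrier: "carrier Z = {0..<int n}" by (auto simp: res_carrier_eq)
  define \<Delta> where "\<Delta> = (\<lambda>u x. (F ((x + u) mod int n) - F x) mod int n)"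
  define D where "D = (\<lambda>u v. {x \<in> {0..<int n}. \<Delta> u x = v})"
  have minus: "x \<ominus>\<^bsub>Z\<^esub> y = (x - y) mod int n" for x y
    by (simp add: a_minus_def res_add_eq res_neg_eq mod_add_right_eq)
  let ?S = "{card (D u v) | u v. u \<in> {0..<int n} \<and> u \<noteq> 0 \<and> v \<in> {0..<int n}}"
  have APN_eq: "APN n F \<longleftrightarrow> Max ?S = 2"
    unfolding APN_def Let_def Z_def [symmetric] carrier D_def \<Delta>_def
    by (simp add: minus res_add_eq res_zero_eq)
  have le2: "card (D u v) \<le> 2" if "u \<in> {0..<int n}" "u \<noteq> 0" "v \<in> {0..<int n}" for u v
  proof (rule ccontr)
    assume "\<not> card (D u v) \<le> 2"
    then have "3 \<le> card (D u v)" by simp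
    then obtain T where T: "T \<subseteq> D u v" "card T = 3" by (rule obtain_subset_with_card_n) 
    from T(2) obtain a b c where abc: "T = {a, b, c}" "a \<noteq> b" "b \<noteq> c" "a \<noteq> c"
      by (auto simp: card_3_iff)
    show False
    proof (rule three[of u v a b c])
      show "u \<in> {0<..<int n}" using that by auto
    qed (use that T(1) abc in \<open>auto simp: D_def \<Delta>_def\<close>)
  qed
  have "card (\<Delta> 1 ` {0..<int n}) < card {0..<int n}"
  proof -
    have "\<Delta> 1 x \<in> {1..<int n}" if x: "x \<in> {0..<int n}" for x
    proof -
      have y: "(x + 1) mod int n \<in> {0..<int n}" using n by simp
      have "\<Delta> 1 x \<noteq> 0"
      proof
        assume "\<Delta> 1 x = 0"
        then have "F ((x + 1) mod int n) mod int n = F x mod int n"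
          by (simp add: \<Delta>_def mod_eq_dvd_iff dvd_eq_mod_eq_0)
        moreover have "F ((x + 1) mod int n) \<in> {0..<int n}" "F x \<in> {0..<int n}" using F(2) x y by blast+
        ultimately have "F ((x + 1) mod int n) = F x" by simp
        then have "(x + 1) mod int n = x mod int n" using inj_onD[OF F(1) _ y x] x by simp
        then have "int n dvd 1" by (simp add: mod_eq_dvd_iff)
        then show False using n by simp
      qed
      moreover have "0 \<le> \<Delta> 1 x" "\<Delta> 1 x < int n" using n by (auto simp: \<Delta>_def)
      ultimately show ?thesis by simp
    qed
    then have "card (\<Delta> 1 ` {0..<int n}) \<le> card {1..<int n}" by (intro card_mono) auto
    then show ?thesis using n by simp
  qed
  then have "\<not> inj_on (\<Delta> 1) {0..<int n}" by (rule pigeonhole)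
  then obtain x y where xy: "x \<in> {0..<int n}" "y \<in> {0..<int n}" "x \<noteq> y" "\<Delta> 1 x = \<Delta> 1 y"
    by (auto simp: inj_on_def)
  have v: "\<Delta> 1 x \<in> {0..<int n}" using n by (simp add: \<Delta>_def)
  have fin: "finite (D u v)" for u v unfolding D_def by (rule finite_subset[of _ "{0..<int n}"]) auto
  have "card {x, y} \<le> card (D 1 (\<Delta> 1 x))"
    using xy by (intro card_mono fin) (auto simp: D_def)
  then have two: "card (D 1 (\<Delta> 1 x)) = 2" using le2[of 1 "\<Delta> 1 x"] n v xy(3) by simp
  have "Max ?S = 2"
  proof (rule Max_eqI)
    show "finite ?S"
      by (rule finite_subset[of _ "(\<lambda>(u,v). card (D u v)) ` ({0..<int n} \<times> {0..<int n})"]) auto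
    show "k \<le> 2" if "k \<in> ?S" for k using that le2 by auto
    have "2 = card (D 1 (\<Delta> 1 x)) \<and> 1 \<in> {0..<int n} \<and> (1::int) \<noteq> 0 \<and> \<Delta> 1 x \<in> {0..<int n}"
      using two v n by simp
    then show "2 \<in> ?S" by blast
  qed
  then show ?thesis using APN_eq by simp
qed

context singer
begin

lemma pgl2_act_generator_power: "pgl2_act (pgl_class r [^]\<^bsub>PGL2\<^esub> int k) (line v0) = line (pt k)"
  using pgl_class_mpow[OF r_inv, of k] by (simp add: int_pow_int pgl2_act_line pt_def)

lemma singer_map_eq_induced:
  assumes "invertible A"
  shows "singer_map (pgl_class r) (line v0) (pgl_class A) (int i) = int (induced A i)"
  unfolding singer_map_def
proof (rule the_equality)
  show "int (induced A i) \<in> carrier (residue_ring (int (CARD('k) + 1))) \<and>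
    pgl2_act (pgl_class A) (pgl2_act (pgl_class r [^]\<^bsub>PGL2\<^esub> int i) (line v0)) =
    pgl2_act (pgl_class r [^]\<^bsub>PGL2\<^esub> int (induced A i)) (line v0)"
    using induced[OF assms, of i] by (simp add: pgl2_act_generator_power pgl2_act_line residue_ring_def n)
next
  fix j assume j: "j \<in> carrier (residue_ring (int (CARD('k) + 1))) \<and>
    pgl2_act (pgl_class A) (pgl2_act (pgl_class r [^]\<^bsub>PGL2\<^esub> int i) (line v0)) =
    pgl2_act (pgl_class r [^]\<^bsub>PGL2\<^esub> j) (line v0)"
  then have "j \<ge> 0" "j < int n" by (auto simp: residue_ring_def n)
  then obtain k where k: "j = int k" "k < n" by (metis nonneg_int_cases of_nat_less_iff)
  have "line (A *v pt i) = line (pt k)"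
    using j unfolding k(1) by (simp add: pgl2_act_generator_power pgl2_act_line)
  then have "line (pt k) = line (pt (induced A i))" using induced(2)[OF assms, of i] by simp
  then show "j = int (induced A i)"
    using k induced(1)[OF assms, of i] by (simp add: line_pt_eq_iff cong_def)
qed

lemma singer_map_bij_APN:
  assumes odd: "odd CARD('k)" and A: "invertible A"
    and nc: "\<nexists>d. A ** mpow r (n div 2) = mat d ** (mpow r (n div 2) ** A)"
  defines "F \<equiv> singer_map (pgl_class r) (line v0) (pgl_class A)"
  shows "bij_betw F {0..<int n} {0..<int n}" "APN n F"
proof -
  have F: "F (int i) = int (induced A i)" for i unfolding F_def by (rule singer_map_eq_induced[OF A])
  have range: "F ` {0..<int n} \<subseteq> {0..<int n}"
  proof (rule image_subsetI)
    fix x assume "x \<in> {0..<int n}"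
    then obtain i where "x = int i" by (auto elim: nonneg_int_cases)
    then show "F x \<in> {0..<int n}" using F induced(1)[OF A] by simp
  qed
  have inj: "inj_on F {0..<int n}"
  proof (rule inj_onI)
    fix x y assume *: "x \<in> {0..<int n}" "y \<in> {0..<int n}" "F x = F y"
    then obtain i j where "x = int i" "y = int j" by (auto elim!: nonneg_int_cases)
    then show "x = y" using * F inj_onD[OF induced_inj[OF A], of i j] by simp
  qed
  show "bij_betw F {0..<int n} {0..<int n}"
    using endo_inj_surj[OF _ range inj] inj by (simp add: bij_betw_def)
  show "APN n F"
  proof (rule APN_if_no_three_solutions[OF _ inj range])
    show "n \<ge> 2" using n_ge_3 by simp
  next
    fix u v a b c
    assume uv: "u \<in> {0<..<int n}" "v \<in> {0..<int n}" and abc: "{a, b, c} \<subseteq> {0..<int n}" "a \<noteq> b" "a \<noteq> c" "b \<noteq> c"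
      and d: "(F ((a + u) mod int n) - F a) mod int n = v" "(F ((b + u) mod int n) - F b) mod int n = v"
        "(F ((c + u) mod int n) - F c) mod int n = v"
    define u' v' where "u' = nat u" "v' = nat v"
    then have u': "u = int u'" and v': "v = int v'" using uv by auto
    have "u' > 0" "u' < n" using uv u' by auto
    then have nu: "\<not> n dvd u'" using dvd_imp_le[of n u'] by auto
    have cong: "[induced A ((x + u') mod n) = v' + induced A x] (mod n)"
      if "(F ((int x + u) mod int n) - F (int x)) mod int n = v" for x
    proof -
      have "(int x + u) mod int n = int ((x + u') mod n)" by (simp add: u' zmod_int)
      then have "(int (induced A ((x + u') mod n)) - int (induced A x)) mod int n = int v'"
        using that F v' by simp
      then have "[int (induced A ((x + u') mod n)) - int (induced A x) = int v'] (mod int n)"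
        by (metis cong_def mod_mod_trivial)
      then have "[int (induced A ((x + u') mod n)) - int (induced A x) + int (induced A x) = int v' + int (induced A x)] (mod int n)"
        by (rule cong_add) simp
      then show ?thesis by (simp flip: cong_int_iff)
    qed
    define x where "x = (\<lambda>i::nat. nat (if i = 0 then a else if i = 1 then b else c))"
    have "x i < n" "[induced A ((x i + u') mod n) = v' + induced A (x i)] (mod n)" if "i < 3" for i
      using abc d cong[of "x i"] by (auto simp: x_def nat_less_iff)
    moreover have "x i \<noteq> x j" if "i < j" "j < 3" for i j
      using that abc by (auto simp: x_def eq_nat_nat_iff)
    ultimately have "\<exists>d. A ** mpow r (n div 2) = mat d ** (mpow r (n div 2) ** A)"
      by (intro derivative_three_solutions[OF odd A nu, of x v']) auto
    then show False using nc by blast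
  qed
qed

end

text \<open>All representatives of the classes are chosen here. Since \<open>R\<close> generates the Singer
  group, it has order \<open>n\<close>, which is the hypothesis of the locale \<open>singer\<close>. Moreover,
  \<open>M\<close> commutes with the class of \<open>r^(n/2)\<close> as soon as matrix representatives
  commute up to a factor, which is then nonzero by invertibility.\<close>

lemma singer_map_permutation_APN:
  fixes C :: "'k::{field,finite} pgl2 set"
  assumes odd: "odd CARD('k)" and n: "n = CARD('k) + 1"
    and C: "singer_group C" "R \<in> C" "generate PGL2 {R} = C" and P0: "P0 \<in> proj_line"
    and M: "M \<in> carrier PGL2" "M \<otimes>\<^bsub>PGL2\<^esub> R [^]\<^bsub>PGL2\<^esub> (n div 2) \<noteq> R [^]\<^bsub>PGL2\<^esub> (n div 2) \<otimes>\<^bsub>PGL2\<^esub> M"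
  shows "bij_betw (singer_map R P0 M) {0..<int n} {0..<int n}" "APN n (singer_map R P0 M)"
proof -
  interpret P: group "PGL2 :: 'k pgl2 monoid" by (rule group_PGL2)
  have R: "R \<in> carrier PGL2" using C subgroup.subset unfolding singer_group_def by blast
  then obtain r where r: "invertible r" "R = pgl_class r" by (rule carrier_PGL2E)
  obtain A where A: "invertible A" "M = pgl_class A" using M(1) by (rule carrier_PGL2E)
  obtain v0 where v0: "v0 \<noteq> 0" "P0 = line v0" using P0 by (auto simp: proj_line_def)
  note P0_eq = v0(2)
  have "P.ord R = n" using P.generate_pow_card[OF R] C n by (simp add: singer_group_def)
  then have "(\<exists>c. mpow r k = mat c) \<longleftrightarrow> n dvd k" for k
    using P.pow_eq_id[OF R, of k] pgl_class_mpow[OF r(1), of k] pgl_class_eq_one_iff[OF invertible_mpow[OF r(1)], of k] r(2)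
    by simp
  then interpret singer r v0 n using r v0 n by unfold_locales auto
  have J: "invertible (mpow r (n div 2))" using invertible_mpow r(1) by blast
  have "\<nexists>d. A ** mpow r (n div 2) = mat d ** (mpow r (n div 2) ** A)"
  proof
    assume "\<exists>d. A ** mpow r (n div 2) = mat d ** (mpow r (n div 2) ** A)"
    then obtain d where d: "A ** mpow r (n div 2) = mat d ** (mpow r (n div 2) ** A)" by blast
    have "d \<noteq> 0"
    proof
      assume "d = 0"
      then have "A ** mpow r (n div 2) = 0" unfolding d by (simp add: mat2_simps)
      moreover have "invertible (A ** mpow r (n div 2))" using A J invertible_mult by blast
      ultimately show False by (auto simp: invertible_def mat2_simps)
    qed
    then have "pgl_class (A ** mpow r (n div 2)) = pgl_class (mpow r (n div 2) ** A)"
      using d pgl_class_eq_iff by blast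
    then show False using M(2) A r J by (simp add: pgl_class_mpow pgl_class_mult)
  qed
  from singer_map_bij_APN[OF odd A(1) this]
  show "bij_betw (singer_map R P0 M) {0..<int n} {0..<int n}" "APN n (singer_map R P0 M)"
    unfolding r(2) A(2) P0_eq by simp_all
qed

section \<open>The orders in the progression\<close>

lemma not_primepow_two_primes:
  assumes "prime a" "prime b" "a \<noteq> b" "a dvd k" "b dvd k" shows "\<not> primepow (k :: nat)"
proof
  assume "primepow k"
  then obtain p e where p: "prime p" "k = p ^ e" by (auto simp: primepow_def)
  have "a dvd p" "b dvd p"
    using prime_dvd_power[OF assms(1)] prime_dvd_power[OF assms(2)] assms(4,5) p(2) by auto
  then have "a = p" "b = p" using primes_dvd_imp_eq[OF _ p(1)] assms(1,2) by auto
  then show False using assms(3) by simp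
qed

text \<open>Every claim depends on \<open>q\<close> only modulo a divisor of \<open>471240\<close>. In particular
  \<open>n \<equiv> 4\<close> modulo \<open>8\<close> and \<open>n \<equiv> 3\<close> modulo \<open>9\<close>, and \<open>n = 2 p\<close> would force \<open>p = 2\<close>
  and \<open>n = 4\<close>.\<close>

lemma order_arithmetic:
  fixes q n :: nat
  assumes q: "[q = 269363] (mod 471240)" and n: "n = q + 1"
  shows "multiplicity 3 n = 1" "multiplicity 2 n = 2"
    "\<not> primepow (n + 1)" "\<not> primepow (n + 2)" "\<not> primepow (n + 3)" "\<not> primepow (n + 4)"
    "\<And>p. prime p \<Longrightarrow> n \<noteq> 2 * p" "odd q"
proof -
  have mod_eq: "q mod d = 269363 mod d" if "d dvd 471240" for d
    using cong_dvd_modulus_nat[OF q that] by (simp only: cong_def)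
  have n8: "n mod 8 = 4" and n9: "n mod 9 = 3" by (simp_all add: n mod_Suc mod_eq)
  have n3: "3 dvd n" "\<not> 9 dvd n" using mod_mod_cancel[of 3 9 n] n9 by (simp_all add: dvd_eq_mod_eq_0)
  then show "multiplicity 3 n = 1" by (intro multiplicity_eqI) auto
  have n4: "4 dvd n" "\<not> 8 dvd n" using mod_mod_cancel[of 4 8 n] n8 by (simp_all add: dvd_eq_mod_eq_0)
  then show "multiplicity 2 n = 2" by (intro multiplicity_eqI) auto
  have "even n" using n4(1) dvd_trans[of 2 4 n] by simp
  then show "odd q" by (simp add: n)
  have dvd_add: "d dvd n + i" if "(q mod d + (i + 1)) mod d = 0" for d i
    using that unfolding n mod_add_left_eq by (simp add: dvd_eq_mod_eq_0)
  have "5 dvd n + 1" "17 dvd n + 1" "3 dvd n + 3" "7 dvd n + 3" "2 dvd n + 4" "11 dvd n + 4"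
    by (rule dvd_add; simp add: mod_eq)+
  then show "\<not> primepow (n + 1)" "\<not> primepow (n + 3)" "\<not> primepow (n + 4)"
    using not_primepow_two_primes[of 5 17] not_primepow_two_primes[of 3 7] not_primepow_two_primes[of 2 11]
    by simp_all
  show "\<not> primepow (n + 2)"
  proof
    assume "primepow (n + 2)"
    then obtain p e where p: "prime p" "n + 2 = p ^ e" by (auto simp: primepow_def)
    have n2: "2 dvd n + 2" "\<not> 4 dvd n + 2" "n + 2 > 2"
      using \<open>even n\<close> dvd_add_right_iff[OF n4(1), of 2] by (simp_all add: n)
    have "2 dvd p" using n2(1) prime_dvd_power[OF two_is_prime_nat, of p e] unfolding p(2) by blast
    then have "p = 2" using primes_dvd_imp_eq[OF two_is_prime_nat p(1)] by simp
    then have "n + 2 = 2 ^ e" using p(2) by simp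
    moreover have "e \<ge> 2"
    proof (rule ccontr)
      assume "\<not> e \<ge> 2"
      then have "(2::nat) ^ e \<le> 2 ^ 1" by (intro power_increasing) auto
      then show False using \<open>n + 2 = 2 ^ e\<close> n2(3) by simp
    qed
    then have "(2::nat) ^ 2 dvd 2 ^ e" by (rule le_imp_power_dvd)
    ultimately show False using n2(2) by simp
  qed
  show "n \<noteq> 2 * p" if "prime p" for p
  proof
    assume np: "n = 2 * p"
    then have "2 * 2 dvd 2 * p" using n4(1) by simp
    then have "p = 2" using primes_dvd_imp_eq[OF two_is_prime_nat that] by simp
    then show False using np n9 by simp
  qed
qed

theorem theorem2:
  "infinite {q::nat. prime q \<and> [q = 269363] (mod 471240)} \<and>
   (\<forall>q n :: nat. prime q \<and> [q = 269363] (mod 471240) \<and> n = q + 1 \<longrightarrow>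
      multiplicity 3 n = 1 \<and> multiplicity 2 n = 2 \<and>
      \<not> primepow (n + 1) \<and> \<not> primepow (n + 2) \<and> \<not> primepow (n + 3) \<and> \<not> primepow (n + 4) \<and>
      (\<forall>p::nat. prime p \<longrightarrow> n \<noteq> 2 * p) \<and>
      (\<forall>(C :: 'k::{field,finite} pgl2 set) R P0 M J.
         CARD('k) = q \<and> singer_group C \<and> R \<in> C \<and> generate PGL2 {R} = C \<and>
         P0 \<in> proj_line \<and> J = R [^]\<^bsub>PGL2\<^esub> (n div 2) \<and>
         M \<in> carrier PGL2 \<and> M \<otimes>\<^bsub>PGL2\<^esub> J \<noteq> J \<otimes>\<^bsub>PGL2\<^esub> M \<longrightarrow>
           (let Z = residue_ring (int n); F = singer_map R P0 M in
              bij_betw F (carrier Z) (carrier Z) \<and> APN n F \<and>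
              (\<forall>r::nat. primepow r \<longrightarrow>
                 int (card (carrier Z)) \<notin> {int r - 1, int r - 2, int r - 3, int r - 4}))))"
proof (intro conjI allI impI)
  have "coprime (269363::nat) 471240"
    by (simp add: coprime_iff_gcd_eq_1 gcd_non_0_nat)
  then show "infinite {q::nat. prime q \<and> [q = 269363] (mod 471240)}"
    by (intro infinite_primes_in_residue_class) auto
next
  fix q n :: nat
  assume "prime q \<and> [q = 269363] (mod 471240) \<and> n = q + 1"
  then have n: "[q = 269363] (mod 471240)" "n = q + 1" by auto
  note arith = order_arithmetic[OF n]
  show "multiplicity 3 n = 1" "multiplicity 2 n = 2"
    "\<not> primepow (n + 1)" "\<not> primepow (n + 2)" "\<not> primepow (n + 3)" "\<not> primepow (n + 4)"
    using arith by auto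
  show "n \<noteq> 2 * p" if "prime p" for p using arith(7)[OF that] .
  fix C :: "'k pgl2 set" and R M J :: "'k pgl2" and P0 :: "('k ^ 2) set"
  assume *: "CARD('k) = q \<and> singer_group C \<and> R \<in> C \<and> generate PGL2 {R} = C \<and>
         P0 \<in> proj_line \<and> J = R [^]\<^bsub>PGL2\<^esub> (n div 2) \<and>
         M \<in> carrier PGL2 \<and> M \<otimes>\<^bsub>PGL2\<^esub> J \<noteq> J \<otimes>\<^bsub>PGL2\<^esub> M"
  have carrier: "carrier (residue_ring (int n)) = {0..<int n}" by (auto simp: residue_ring_def)
  have "bij_betw (singer_map R P0 M) {0..<int n} {0..<int n}" "APN n (singer_map R P0 M)"
    using singer_map_permutation_APN[of n C R P0 M] * n(2) arith(8) by auto
  moreover have "int n \<notin> {int r - 1, int r - 2, int r - 3, int r - 4}" if "primepow r" for r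
  proof
    assume "int n \<in> {int r - 1, int r - 2, int r - 3, int r - 4}"
    then have "r = n + 1 \<or> r = n + 2 \<or> r = n + 3 \<or> r = n + 4" by auto
    then show False using that arith by auto
  qed
  ultimately show "let Z = residue_ring (int n); F = singer_map R P0 M in
              bij_betw F (carrier Z) (carrier Z) \<and> APN n F \<and>
              (\<forall>r::nat. primepow r \<longrightarrow>
                 int (card (carrier Z)) \<notin> {int r - 1, int r - 2, int r - 3, int r - 4})"
    by (simp add: carrier Let_def)
qed

end
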